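(* Let $q\in\mathbb{C}^\times=\mathbb{C}\setminus\{0\}$, $n\in\mathbb{N}$, and $r\in(0,+\infty]$. (i) There exists a surjective continuous homomorphism $\pi\colon\mathcal{F}(\mathbb{B}^n_r)\to\mathcal{O}_q(\mathbb{B}^n_r)$ such that $\pi(\zeta_i)=x_i$ for $i=1,\dots,n$. (ii) $\mathrm{Ker}\,\pi$ coincides with the closed two-sided ideal of $\mathcal{F}(\mathbb{B}^n_r)$ generated by the elements $\zeta_i\zeta_j-q\zeta_j\zeta_i$ ($i,j=1,\dots,n$, $i<j$). (iii) $\mathrm{Ker}\,\pi$ is a complemented subspace of $\mathcal{F}(\mathbb{B}^n_r)$. (iv) Under the identification $\mathcal{O}_q(\mathbb{B}^n_r)\cong\mathcal{F}(\mathbb{B}^n_r)/\mathrm{Ker}\,\pi$, for each $\rho\in(0,r)$ the norm $\|\cdot\|_{\mathbb{B},\rho}$ on $\mathcal{O}_q(\mathbb{B}^n_r)$ is equal to the quotient of the norm $\|\cdot\|^\circ_\rho$ on $\mathcal{F}(\mathbb{B}^n_r)$.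
   Context: All algebras are complex, associative and unital, homomorphisms are unital. $\mathbb{Z}_+=\{0,1,2,\dots\}$; $W_{n,d}=\{1,\dots,n\}^d$, $W_n=\bigsqcup_{d\ge0}W_{n,d}$; for $\alpha\in W_{n,d}$ put $|\alpha|=d$ and $\zeta_\alpha=\zeta_{\alpha_1}\cdots\zeta_{\alpha_d}$ ($=1$ if $d=0$). $\mathfrak{F}_n$ is the algebra of all formal series $\sum_{\alpha\in W_n}c_\alpha\zeta_\alpha$ in free variables $\zeta_1,\dots,\zeta_n$. The map $\mathrm{p}\colon W_n\to\mathbb{Z}_+^n$ sends $\alpha$ to $(\mathrm{p}_1(\alpha),\dots,\mathrm{p}_n(\alpha))$, where $\mathrm{p}_i(\alpha)$ is the number of occurrences of $i$ in $\alpha$. The free ball algebra is $$\mathcal{F}(\mathbb{B}^n_r)=\Bigl\{a=\sum_{\alpha}c_\alpha\zeta_\alpha\in\mathfrak{F}_n:\ \|a\|^\bullet_\rho=\sum_{d=0}^\infty\Bigl(\sum_{|\alpha|=d}|c_\alpha|^2\Bigr)^{1/2}\rho^d<\infty\ \ \forall\rho\in(0,r)\Bigr\},$$ a Fréchet algebra with multiplication from $\mathfrak{F}_n$ and topology given by the norms $\|\cdot\|^\bullet_\rho$. The family of norms $$\|a\|^\circ_\rho=\sum_{k\in\mathbb{Z}_+^n}\Bigl(\sum_{\alpha\in\mathrm{p}^{-1}(k)}|c_\alpha|^2\Bigr)^{1/2}\rho^{|k|}\qquad(0<\rho<r)$$ is finite on $\mathcal{F}(\mathbb{B}^n_r)$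 and defines the same topology. The quantum ball algebra: for $k\in\mathbb{Z}_+^n$ let $|k|=k_1+\cdots+k_n$, $u_q(k)=|q|^{\sum_{i<j}k_ik_j}$. For $t>0$ and $m\in\mathbb{N}$ let $[m]_t=1+t+\cdots+t^{m-1}$, $[m]_t!=[1]_t\cdots[m]_t$, $[0]_t!=1$, and $[k]_t!=[k_1]_t!\cdots[k_n]_t!$. Then $$\mathcal{O}_q(\mathbb{B}^n_r)=\Bigl\{f=\sum_{k\in\mathbb{Z}_+^n}c_kx^k:\ \|f\|_{\mathbb{B},\rho}=\sum_k|c_k|\Bigl(\frac{[k]_{|q|^2}!}{[|k|]_{|q|^2}!}\Bigr)^{1/2}u_q(k)\rho^{|k|}<\infty\ \ \forall\rho\in(0,r)\Bigr\},$$ where $x^k=x_1^{k_1}\cdots x_n^{k_n}$, with topology given by the norms $\|\cdot\|_{\mathbb{B},\rho}$ and the continuous multiplication uniquely determined by $x_ix_j=qx_jx_i$ for $i<j$; it is a Fréchet algebra and the norms $\|\cdot\|_{\mathbb{B},\rho}$ are submultiplicative. A closed subspace of a Fréchet space is complemented if it has a closed topological complement. The quotient of a norm $\|\cdot\|$ under a surjection $\pi$ is $f\mapsto\inf\{\|a\|:\pi(a)=f\}$. *)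

theory Defs
  imports
    "HOL-Analysis.Analysis"
    "HOL-Algebra.Module"
    "HOL-Algebra.Ideal"
begin

section \<open>Algebras of coefficient families\<close>

text \<open>
  Both algebras consist of formal series, represented by their coefficient functions.
  Complex algebras, not necessarily commutative, are represented by \<^type>\<open>module\<close> records
  (ring operations together with a scalar multiplication).
\<close>

definition alg_hom ::
    "(complex, 'a, 'm) module_scheme \<Rightarrow> (complex, 'b, 'k) module_scheme \<Rightarrow> ('a \<Rightarrow> 'b) set" where
  "alg_hom A B = {h \<in> ring_hom A B. \<forall>c. \<forall>a \<in> carrier A. h (c \<odot>\<^bsub>A\<^esub> a) = c \<odot>\<^bsub>B\<^esub> h a}"

definition lin_subspace :: "(complex, 'a, 'm) module_scheme \<Rightarrow> 'a set \<Rightarrow> bool" where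
  "lin_subspace A M \<longleftrightarrow> M \<subseteq> carrier A \<and> \<zero>\<^bsub>A\<^esub> \<in> M \<and>
     (\<forall>a \<in> M. \<forall>b \<in> M. a \<oplus>\<^bsub>A\<^esub> b \<in> M) \<and> (\<forall>c. \<forall>a \<in> M. c \<odot>\<^bsub>A\<^esub> a \<in> M)"

text \<open>The topology on \<open>A\<close> given by a family of norms \<open>p \<rho>\<close>, \<open>\<rho> \<in> P\<close>; open balls of
  the individual norms, around arbitrary centres, form a subbase.\<close>

definition norms_topology ::
    "('i \<Rightarrow> complex) set \<Rightarrow> real set \<Rightarrow> (real \<Rightarrow> ('i \<Rightarrow> complex) \<Rightarrow> real) \<Rightarrow> ('i \<Rightarrow> complex) topology"
  where
  "norms_topology A P p = topology_generated_by
     {{b \<in> A. p \<rho> (\<lambda>i. b i - a i) < \<epsilon>} | a \<rho> \<epsilon>. a \<in> A \<and> \<rho> \<in> P \<and> 0 < \<epsilon>}"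

text \<open>Two-sided ideals of a unital algebra are automatically linear subspaces.\<close>

definition closed_ideal_generated ::
    "(complex, 'a, 'm) module_scheme \<Rightarrow> 'a topology \<Rightarrow> 'a set \<Rightarrow> 'a set" where
  "closed_ideal_generated A T S = \<Inter> {I. ideal I A \<and> closedin T I \<and> S \<subseteq> I}"

text \<open>The complement is topological: addition is a homeomorphism from the product onto the
  whole space (in particular the sum is direct).\<close>

definition complemented_subspace ::
    "(complex, 'a, 'm) module_scheme \<Rightarrow> 'a topology \<Rightarrow> 'a set \<Rightarrow> bool" where
  "complemented_subspace A T K \<longleftrightarrow> lin_subspace A K \<and> closedin T K \<and>
     (\<exists>M. lin_subspace A M \<and> closedin T M \<and>
        homeomorphic_map (prod_topology (subtopology T K) (subtopology T M)) T
          (\<lambda>(a, b). a \<oplus>\<^bsub>A\<^esub> b))"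

definition radii :: "ereal \<Rightarrow> real set" where
  "radii r = {\<rho>. 0 < \<rho> \<and> ereal \<rho> < r}"


section \<open>Index sets\<close>

definition words :: "nat \<Rightarrow> nat list set" where
  "words n = {w. set w \<subseteq> {1..n}}"

definition words_len :: "nat \<Rightarrow> nat \<Rightarrow> nat list set" where
  "words_len n d = {w \<in> words n. length w = d}"

definition multi_indices :: "nat \<Rightarrow> (nat \<Rightarrow> nat) set" where
  "multi_indices n = {k. \<forall>i. i \<notin> {1..n} \<longrightarrow> k i = 0}"

definition multi_size :: "nat \<Rightarrow> (nat \<Rightarrow> nat) \<Rightarrow> nat" where
  "multi_size n k = (\<Sum>i=1..n. k i)"

definition letter_counts :: "nat list \<Rightarrow> nat \<Rightarrow> nat" where
  "letter_counts w = (\<lambda>i. count_list w i)"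

definition words_of_counts :: "nat \<Rightarrow> (nat \<Rightarrow> nat) \<Rightarrow> nat list set" where
  "words_of_counts n k = {w \<in> words n. letter_counts w = k}"


section \<open>The free ball algebra\<close>

definition free_norm :: "nat \<Rightarrow> real \<Rightarrow> (nat list \<Rightarrow> complex) \<Rightarrow> real" where
  "free_norm n \<rho> a = (\<Sum>d. sqrt (\<Sum>w\<in>words_len n d. (cmod (a w))\<^sup>2) * \<rho> ^ d)"

definition free_norm_circ :: "nat \<Rightarrow> real \<Rightarrow> (nat list \<Rightarrow> complex) \<Rightarrow> real" where
  "free_norm_circ n \<rho> a =
     (\<Sum>\<^sub>\<infinity>k\<in>multi_indices n. sqrt (\<Sum>w\<in>words_of_counts n k. (cmod (a w))\<^sup>2) * \<rho> ^ multi_size n k)"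

definition free_ball_carrier :: "nat \<Rightarrow> ereal \<Rightarrow> (nat list \<Rightarrow> complex) set" where
  "free_ball_carrier n r = {a. (\<forall>w. w \<notin> words n \<longrightarrow> a w = 0) \<and>
     (\<forall>\<rho> \<in> radii r. summable (\<lambda>d. sqrt (\<Sum>w\<in>words_len n d. (cmod (a w))\<^sup>2) * \<rho> ^ d))}"

text \<open>The multiplication is the concatenation product: sum over all factorizations of a word.\<close>

definition free_ball :: "nat \<Rightarrow> ereal \<Rightarrow> (complex, nat list \<Rightarrow> complex) module" where
  "free_ball n r =
    \<lparr>carrier = free_ball_carrier n r,
     mult = (\<lambda>a b w. \<Sum>i\<le>length w. a (take i w) * b (drop i w)),
     one = (\<lambda>w. if w = [] then 1 else 0),
     zero = (\<lambda>w. 0),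
     add = (\<lambda>a b w. a w + b w),
     smult = (\<lambda>c a w. c * a w)\<rparr>"

definition free_ball_topology :: "nat \<Rightarrow> ereal \<Rightarrow> (nat list \<Rightarrow> complex) topology" where
  "free_ball_topology n r = norms_topology (free_ball_carrier n r) (radii r) (free_norm n)"

definition free_gen :: "nat \<Rightarrow> nat list \<Rightarrow> complex" where
  "free_gen i = (\<lambda>w. if w = [i] then 1 else 0)"

definition q_commutators :: "complex \<Rightarrow> nat \<Rightarrow> ereal \<Rightarrow> (nat list \<Rightarrow> complex) set" where
  "q_commutators q n r =
    {(free_gen i \<otimes>\<^bsub>free_ball n r\<^esub> free_gen j) \<ominus>\<^bsub>free_ball n r\<^esub>
       (q \<odot>\<^bsub>free_ball n r\<^esub> (free_gen j \<otimes>\<^bsub>free_ball n r\<^esub> free_gen i))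
     | i j. 1 \<le> i \<and> i < j \<and> j \<le> n}"


section \<open>The quantum ball algebra\<close>

definition q_int :: "real \<Rightarrow> nat \<Rightarrow> real" where
  "q_int t m = (\<Sum>i<m. t ^ i)"

definition q_fact :: "real \<Rightarrow> nat \<Rightarrow> real" where
  "q_fact t m = (\<Prod>i=1..m. q_int t i)"

definition q_fact_multi :: "real \<Rightarrow> nat \<Rightarrow> (nat \<Rightarrow> nat) \<Rightarrow> real" where
  "q_fact_multi t n k = (\<Prod>i=1..n. q_fact t (k i))"

definition u_weight :: "complex \<Rightarrow> nat \<Rightarrow> (nat \<Rightarrow> nat) \<Rightarrow> real" where
  "u_weight q n k = cmod q ^ (\<Sum>j=1..n. \<Sum>i=1..<j. k i * k j)"

definition quantum_weight :: "complex \<Rightarrow> nat \<Rightarrow> (nat \<Rightarrow> nat) \<Rightarrow> real" where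
  "quantum_weight q n k =
     sqrt (q_fact_multi ((cmod q)\<^sup>2) n k / q_fact ((cmod q)\<^sup>2) (multi_size n k)) * u_weight q n k"

definition quantum_norm :: "complex \<Rightarrow> nat \<Rightarrow> real \<Rightarrow> ((nat \<Rightarrow> nat) \<Rightarrow> complex) \<Rightarrow> real" where
  "quantum_norm q n \<rho> f =
     (\<Sum>\<^sub>\<infinity>k\<in>multi_indices n. cmod (f k) * quantum_weight q n k * \<rho> ^ multi_size n k)"

definition quantum_ball_carrier :: "complex \<Rightarrow> nat \<Rightarrow> ereal \<Rightarrow> ((nat \<Rightarrow> nat) \<Rightarrow> complex) set" where
  "quantum_ball_carrier q n r = {f. (\<forall>k. k \<notin> multi_indices n \<longrightarrow> f k = 0) \<and>
     (\<forall>\<rho> \<in> radii r.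
        (\<lambda>k. cmod (f k) * quantum_weight q n k * \<rho> ^ multi_size n k) summable_on multi_indices n)}"

text \<open>
  Reordering \<open>x\<^sup>k x\<^sup>l\<close> by means of \<open>x\<^sub>j x\<^sub>i = q\<^sup>-\<^sup>1 x\<^sub>i x\<^sub>j\<close> (\<open>i < j\<close>) moves each of the \<open>l\<^sub>i\<close> factors \<open>x\<^sub>i\<close>
  past each of the \<open>k\<^sub>j\<close> factors \<open>x\<^sub>j\<close>, so \<open>x\<^sup>k x\<^sup>l = q\<^sup>-\<^sup>c x\<^bsup>k+l\<^esup>\<close> with
  \<open>c = (\<Sum>i<j. k\<^sub>j l\<^sub>i)\<close>. Extending bilinearly and continuously gives the multiplication below;
  the lemmas at the end of the theory confirm that it is associative and unital, satisfies the
  defining relations, and makes the coefficient basis consist of the ordered monomials.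
\<close>

definition reorder_exp :: "nat \<Rightarrow> (nat \<Rightarrow> nat) \<Rightarrow> (nat \<Rightarrow> nat) \<Rightarrow> nat" where
  "reorder_exp n k l = (\<Sum>j=1..n. \<Sum>i=1..<j. k j * l i)"

definition quantum_ball ::
    "complex \<Rightarrow> nat \<Rightarrow> ereal \<Rightarrow> (complex, (nat \<Rightarrow> nat) \<Rightarrow> complex) module" where
  "quantum_ball q n r =
    \<lparr>carrier = quantum_ball_carrier q n r,
     mult = (\<lambda>f g m. \<Sum>(k, l) | (\<lambda>i. k i + l i) = m. f k * g l * inverse q ^ reorder_exp n k l),
     one = (\<lambda>k. if k = (\<lambda>_. 0) then 1 else 0),
     zero = (\<lambda>k. 0),
     add = (\<lambda>f g k. f k + g k),
     smult = (\<lambda>c f k. c * f k)\<rparr>"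

definition quantum_ball_topology ::
    "complex \<Rightarrow> nat \<Rightarrow> ereal \<Rightarrow> ((nat \<Rightarrow> nat) \<Rightarrow> complex) topology" where
  "quantum_ball_topology q n r =
     norms_topology (quantum_ball_carrier q n r) (radii r) (quantum_norm q n)"

definition quantum_monom :: "(nat \<Rightarrow> nat) \<Rightarrow> (nat \<Rightarrow> nat) \<Rightarrow> complex" where
  "quantum_monom k = (\<lambda>m. if m = k then 1 else 0)"

definition quantum_gen :: "nat \<Rightarrow> (nat \<Rightarrow> nat) \<Rightarrow> complex" where
  "quantum_gen i = quantum_monom (\<lambda>j. if j = i then 1 else 0)"


subsection \<open>The multiplication is the intended one\<close>

lemma quantum_mult_eq:
  "(f \<otimes>\<^bsub>quantum_ball q n r\<^esub> g) m =
     (\<Sum>(k, l) | (\<lambda>i. k i + l i) = m. f k * g l * inverse q ^ reorder_exp n k l)"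
  by (simp add: quantum_ball_def)

lemma finite_sub_indices:
  assumes "m \<in> multi_indices n"
  shows "finite {k :: nat \<Rightarrow> nat. \<forall>i. k i \<le> m i}"
proof (rule finite_subset)
  show "{k. \<forall>i. k i \<le> m i} \<subseteq> {k. \<forall>i. (i \<in> {1..n} \<longrightarrow> k i \<in> {..(\<Sum>j=1..n. m j)}) \<and> (i \<notin> {1..n} \<longrightarrow> k i = 0)}"
  proof (clarsimp, intro conjI impI)
    fix k i assume le: "\<forall>i. k i \<le> m i"
    show "k i \<le> sum m {Suc 0..n}" if "Suc 0 \<le> i \<and> i \<le> n"
      using le[rule_format, of i] member_le_sum[of i "{Suc 0..n}" m] that by force
    show "k i = 0" if "Suc 0 \<le> i \<longrightarrow> \<not> i \<le> n"
      using le[rule_format, of i] that assms by (auto simp: multi_indices_def)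
  qed
  show "finite {k. \<forall>i. (i \<in> {1..n} \<longrightarrow> k i \<in> {..(\<Sum>j=1..n. m j)}) \<and> (i \<notin> {1..n} \<longrightarrow> k i = (0::nat))}"
    by (rule finite_set_of_finite_funs) auto
qed

lemma finite_splittings:
  assumes "m \<in> multi_indices n"
  shows "finite {(k, l). (\<lambda>i. k i + l i) = (m :: nat \<Rightarrow> nat)}"
proof (rule finite_subset)
  show "{(k, l). (\<lambda>i. k i + l i) = m} \<subseteq> {k. \<forall>i. k i \<le> m i} \<times> {k. \<forall>i. k i \<le> m i}"
    by auto
qed (simp add: finite_sub_indices[OF assms])

lemma multi_indices_add_iff:
  "(\<lambda>i. k i + l i) \<in> multi_indices n \<longleftrightarrow> k \<in> multi_indices n \<and> l \<in> multi_indices n"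
  by (auto simp: multi_indices_def)

lemma quantum_mult_outside:
  assumes "m \<notin> multi_indices n"
    and "\<And>k. k \<notin> multi_indices n \<Longrightarrow> f k = 0" "\<And>k. k \<notin> multi_indices n \<Longrightarrow> g k = 0"
  shows "(f \<otimes>\<^bsub>quantum_ball q n r\<^esub> g) m = 0"
  unfolding quantum_mult_eq
  using assms by (intro sum.neutral) (auto simp: multi_indices_add_iff)

lemma quantum_monom_mult:
  assumes "k \<in> multi_indices n" "l \<in> multi_indices n"
  shows "quantum_monom k \<otimes>\<^bsub>quantum_ball q n r\<^esub> quantum_monom l =
    inverse q ^ reorder_exp n k l \<odot>\<^bsub>quantum_ball q n r\<^esub> quantum_monom (\<lambda>i. k i + l i)"
proof
  fix m :: "nat \<Rightarrow> nat"
  let ?S = "{(k, l). (\<lambda>i. k i + l i) = m}"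
  let ?t = "\<lambda>(k', l'). quantum_monom k k' * quantum_monom l l' * inverse q ^ reorder_exp n k' l'"
  show "(quantum_monom k \<otimes>\<^bsub>quantum_ball q n r\<^esub> quantum_monom l) m =
    (inverse q ^ reorder_exp n k l \<odot>\<^bsub>quantum_ball q n r\<^esub> quantum_monom (\<lambda>i. k i + l i)) m"
  proof (cases "m = (\<lambda>i. k i + l i)")
    case True
    have "sum ?t ?S = sum ?t {(k, l)}"
      using assms True
      by (intro sum.mono_neutral_right finite_splittings[of m n])
         (auto simp: multi_indices_add_iff quantum_monom_def split: if_splits)
    then show ?thesis
      by (simp add: quantum_mult_eq quantum_ball_def quantum_monom_def True)
  next
    case False
    then have "sum ?t ?S = 0"
      by (intro sum.neutral) (auto simp: quantum_monom_def)
    with False show ?thesis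
      by (simp add: quantum_mult_eq quantum_ball_def quantum_monom_def)
  qed
qed

lemma quantum_gen_relation:
  assumes "q \<noteq> 0" "1 \<le> i" "i < j" "j \<le> n"
  shows "quantum_gen i \<otimes>\<^bsub>quantum_ball q n r\<^esub> quantum_gen j =
    q \<odot>\<^bsub>quantum_ball q n r\<^esub> (quantum_gen j \<otimes>\<^bsub>quantum_ball q n r\<^esub> quantum_gen i)"
proof -
  let ?e = "\<lambda>i j. if j = i then 1 else (0::nat)"
  have e: "?e i \<in> multi_indices n" "?e j \<in> multi_indices n"
    using assms by (auto simp: multi_indices_def)
  have "reorder_exp n (?e i) (?e j) = 0"
    using assms by (auto simp: reorder_exp_def)
  moreover have "reorder_exp n (?e j) (?e i) = (\<Sum>b=1..n. if b = j then \<Sum>a=1..<b. ?e i a else 0)"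
    unfolding reorder_exp_def by (intro sum.cong) auto
  then have "reorder_exp n (?e j) (?e i) = 1"
    using assms by simp
  ultimately have
    "quantum_gen i \<otimes>\<^bsub>quantum_ball q n r\<^esub> quantum_gen j =
       1 \<odot>\<^bsub>quantum_ball q n r\<^esub> quantum_monom (\<lambda>a. ?e i a + ?e j a)"
    "quantum_gen j \<otimes>\<^bsub>quantum_ball q n r\<^esub> quantum_gen i =
       inverse q \<odot>\<^bsub>quantum_ball q n r\<^esub> quantum_monom (\<lambda>a. ?e j a + ?e i a)"
    unfolding quantum_gen_def using quantum_monom_mult[OF e, of q r]
      quantum_monom_mult[OF e(2) e(1), of q r] by simp_all
  note this
  moreover have "(\<lambda>a. ?e j a + ?e i a) = (\<lambda>a. ?e i a + ?e j a)"
    by (simp add: add.commute)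
  ultimately show ?thesis
    using assms(1) by (simp only:) (simp add: quantum_ball_def flip: mult.assoc)
qed

lemma quantum_one: "\<one>\<^bsub>quantum_ball q n r\<^esub> = quantum_monom (\<lambda>_. 0)"
  by (auto simp: quantum_ball_def quantum_monom_def)

lemma quantum_gen_pow:
  assumes "1 \<le> i" "i \<le> n"
  shows "quantum_gen i [^]\<^bsub>quantum_ball q n r\<^esub> (d::nat) = quantum_monom (\<lambda>j. if j = i then d else 0)"
proof (induction d)
  case 0
  then show ?case by (simp add: quantum_one)
next
  case (Suc d)
  let ?k = "\<lambda>d j. if j = i then d else (0::nat)"
  have "?k d \<in> multi_indices n" "?k 1 \<in> multi_indices n"
    using assms by (auto simp: multi_indices_def)
  moreover have "reorder_exp n (?k d) (?k 1) = 0"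
    by (auto simp: reorder_exp_def)
  moreover have "(\<lambda>j. ?k d j + ?k 1 j) = ?k (Suc d)"
    by auto
  ultimately have "quantum_monom (?k d) \<otimes>\<^bsub>quantum_ball q n r\<^esub> quantum_gen i = quantum_monom (?k (Suc d))"
    unfolding quantum_gen_def using quantum_monom_mult[of "?k d" n "?k 1" q r]
    by (simp add: quantum_ball_def)
  with Suc show ?case
    by simp
qed

lemma quantum_monom_eq_ordered_product:
  assumes "k \<in> multi_indices n"
  shows "quantum_monom k =
    foldl (\<lambda>f i. f \<otimes>\<^bsub>quantum_ball q n r\<^esub> (quantum_gen i [^]\<^bsub>quantum_ball q n r\<^esub> k i))
      \<one>\<^bsub>quantum_ball q n r\<^esub> [1..<Suc n]"
proof -
  let ?Q = "quantum_ball q n r"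
  have "foldl (\<lambda>f i. f \<otimes>\<^bsub>?Q\<^esub> (quantum_gen i [^]\<^bsub>?Q\<^esub> k i)) \<one>\<^bsub>?Q\<^esub> [1..<Suc d] =
      quantum_monom (\<lambda>i. if i \<le> d then k i else 0)" if "d \<le> n" for d
    using that
  proof (induction d)
    case 0
    have "(\<lambda>i. if i \<le> 0 then k i else 0) = (\<lambda>_. 0)"
      using assms by (auto simp: multi_indices_def)
    then show ?case by (simp add: quantum_one)
  next
    case (Suc d)
    let ?a = "\<lambda>i. if i \<le> d then k i else 0" and ?b = "\<lambda>j. if j = Suc d then k (Suc d) else 0"
    have "?a \<in> multi_indices n" "?b \<in> multi_indices n"
      using assms Suc.prems by (auto simp: multi_indices_def)
    moreover have "reorder_exp n ?a ?b = 0"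
      by (auto simp: reorder_exp_def)
    moreover have "(\<lambda>i. ?a i + ?b i) = (\<lambda>i. if i \<le> Suc d then k i else 0)"
      by (auto simp: le_Suc_eq)
    ultimately have "quantum_monom ?a \<otimes>\<^bsub>?Q\<^esub> quantum_monom ?b =
        quantum_monom (\<lambda>i. if i \<le> Suc d then k i else 0)"
      using quantum_monom_mult[of ?a n ?b q r] by (simp add: quantum_ball_def)
    with Suc show ?case
      by (simp add: quantum_gen_pow)
  qed
  from this[of n] have "foldl (\<lambda>f i. f \<otimes>\<^bsub>?Q\<^esub> (quantum_gen i [^]\<^bsub>?Q\<^esub> k i)) \<one>\<^bsub>?Q\<^esub> [1..<Suc n] =
      quantum_monom (\<lambda>i. if i \<le> n then k i else 0)"
    by simp
  also have "(\<lambda>i. if i \<le> n then k i else 0) = k"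
    using assms by (auto simp: multi_indices_def)
  finally show ?thesis by simp
qed

lemma reorder_exp_add:
  "reorder_exp n (\<lambda>i. k i + k' i) l = reorder_exp n k l + reorder_exp n k' l"
  "reorder_exp n l (\<lambda>i. k i + k' i) = reorder_exp n l k + reorder_exp n l k'"
  by (simp_all add: reorder_exp_def sum.distrib algebra_simps)

lemma quantum_mult_assoc:
  assumes f: "\<And>k. k \<notin> multi_indices n \<Longrightarrow> f k = 0"
    and g: "\<And>k. k \<notin> multi_indices n \<Longrightarrow> g k = 0"
    and h: "\<And>k. k \<notin> multi_indices n \<Longrightarrow> h k = 0"
  shows "(f \<otimes>\<^bsub>quantum_ball q n r\<^esub> g) \<otimes>\<^bsub>quantum_ball q n r\<^esub> h =
    f \<otimes>\<^bsub>quantum_ball q n r\<^esub> (g \<otimes>\<^bsub>quantum_ball q n r\<^esub> h)"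
proof
  fix m
  let ?Q = "quantum_ball q n r"
  let ?S = "\<lambda>m. {(k, l). (\<lambda>i. k i + l i) = (m :: nat \<Rightarrow> nat)}"
  let ?c = "\<lambda>k l. inverse q ^ reorder_exp n k l"
  show "((f \<otimes>\<^bsub>?Q\<^esub> g) \<otimes>\<^bsub>?Q\<^esub> h) m = (f \<otimes>\<^bsub>?Q\<^esub> (g \<otimes>\<^bsub>?Q\<^esub> h)) m"
  proof (cases "m \<in> multi_indices n")
    case False
    have "((f \<otimes>\<^bsub>?Q\<^esub> g) \<otimes>\<^bsub>?Q\<^esub> h) m = 0" "(f \<otimes>\<^bsub>?Q\<^esub> (g \<otimes>\<^bsub>?Q\<^esub> h)) m = 0"
      using False f g h by (auto intro!: quantum_mult_outside)
    then show ?thesis by simp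
  next
    case True
    have fin: "finite (?S (fst z))" "finite (?S (snd z))" if "z \<in> ?S m" for z
      using that True by (auto intro!: finite_splittings[of _ n] simp: multi_indices_add_iff)
    have "((f \<otimes>\<^bsub>?Q\<^esub> g) \<otimes>\<^bsub>?Q\<^esub> h) m =
      (\<Sum>z\<in>?S m. \<Sum>y\<in>?S (fst z). f (fst y) * g (snd y) * ?c (fst y) (snd y) * h (snd z) * ?c (fst z) (snd z))"
      unfolding quantum_mult_eq by (simp add: case_prod_unfold sum_distrib_right)
    also have "\<dots> = (\<Sum>(z, y)\<in>(SIGMA z:?S m. ?S (fst z)).
        f (fst y) * g (snd y) * ?c (fst y) (snd y) * h (snd z) * ?c (fst z) (snd z))"
      using fin finite_splittings[OF True] by (subst sum.Sigma) auto
    also have "\<dots> = (\<Sum>(z, y)\<in>(SIGMA z:?S m. ?S (snd z)).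
        f (fst z) * (g (fst y) * h (snd y) * ?c (fst y) (snd y)) * ?c (fst z) (snd z))"
      by (rule sum.reindex_bij_witness
          [where i = "\<lambda>((a, _), (b, c)). (((\<lambda>i. a i + b i), c), (a, b))"
             and j = "\<lambda>((_, c), (a, b)). ((a, (\<lambda>i. b i + c i)), (b, c))"])
         (auto simp: add.assoc reorder_exp_add power_add)
    also have "\<dots> = (\<Sum>z\<in>?S m. \<Sum>y\<in>?S (snd z).
        f (fst z) * (g (fst y) * h (snd y) * ?c (fst y) (snd y)) * ?c (fst z) (snd z))"
      using fin finite_splittings[OF True] by (subst sum.Sigma) auto
    also have "\<dots> = (f \<otimes>\<^bsub>?Q\<^esub> (g \<otimes>\<^bsub>?Q\<^esub> h)) m"
      unfolding quantum_mult_eq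
      by (simp add: case_prod_unfold sum_distrib_right sum_distrib_left)
    finally show ?thesis .
  qed
qed

lemma quantum_mult_one:
  assumes f: "\<And>k. k \<notin> multi_indices n \<Longrightarrow> f k = 0"
  shows "\<one>\<^bsub>quantum_ball q n r\<^esub> \<otimes>\<^bsub>quantum_ball q n r\<^esub> f = f"
    and "f \<otimes>\<^bsub>quantum_ball q n r\<^esub> \<one>\<^bsub>quantum_ball q n r\<^esub> = f"
proof -
  let ?Q = "quantum_ball q n r"
  let ?S = "\<lambda>m. {(k, l). (\<lambda>i. k i + l i) = (m :: nat \<Rightarrow> nat)}"
  have r0: "reorder_exp n (\<lambda>_. 0) k = 0" "reorder_exp n k (\<lambda>_. 0) = 0" for k
    by (simp_all add: reorder_exp_def)
  have o: "\<one>\<^bsub>?Q\<^esub> k = 0" if "k \<notin> multi_indices n" for k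
    using that by (auto simp: quantum_ball_def multi_indices_def)
  have "(\<one>\<^bsub>?Q\<^esub> \<otimes>\<^bsub>?Q\<^esub> f) m = f m" for m
  proof (cases "m \<in> multi_indices n")
    case True
    have "(\<one>\<^bsub>?Q\<^esub> \<otimes>\<^bsub>?Q\<^esub> f) m =
        (\<Sum>(k, l)\<in>{(\<lambda>_. 0, m)}. quantum_monom (\<lambda>_. 0) k * f l * inverse q ^ reorder_exp n k l)"
      unfolding quantum_mult_eq quantum_one using finite_splittings[OF True]
      by (intro sum.mono_neutral_right) (auto simp: quantum_monom_def split: if_splits)
    then show ?thesis
      by (simp add: quantum_monom_def r0)
  qed (use quantum_mult_outside[where g = f, OF _ o f] f in auto)
  then show "\<one>\<^bsub>?Q\<^esub> \<otimes>\<^bsub>?Q\<^esub> f = f" by auto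
  have "(f \<otimes>\<^bsub>?Q\<^esub> \<one>\<^bsub>?Q\<^esub>) m = f m" for m
  proof (cases "m \<in> multi_indices n")
    case True
    have "(f \<otimes>\<^bsub>?Q\<^esub> \<one>\<^bsub>?Q\<^esub>) m =
        (\<Sum>(k, l)\<in>{(m, \<lambda>_. 0)}. f k * quantum_monom (\<lambda>_. 0) l * inverse q ^ reorder_exp n k l)"
      unfolding quantum_mult_eq quantum_one using finite_splittings[OF True]
      by (intro sum.mono_neutral_right) (auto simp: quantum_monom_def split: if_splits)
    then show ?thesis
      by (simp add: quantum_monom_def r0)
  qed (use quantum_mult_outside[where f = f, OF _ f o] f in auto)
  then show "f \<otimes>\<^bsub>?Q\<^esub> \<one>\<^bsub>?Q\<^esub> = f" by auto
qed

end

theory Submission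
  imports Defs
begin

text \<open>
  The homomorphism \<open>\<pi>\<close> sends a word \<open>w\<close> to \<open>q\<^sup>-\<^sup>m x\<^sup>k\<close>, where \<open>k\<close> counts the letters of \<open>w\<close> and \<open>m\<close>
  is the number of inversions of \<open>w\<close>. By MacMahon's \<open>q\<close>-multinomial theorem, the coefficients
  \<open>q\<^sup>-\<^sup>m\<close> of the words with letter counts \<open>k\<close> form a vector whose Euclidean norm is the reciprocal
  of the weight of \<open>x\<^sup>k\<close> in the quantum ball norms. Hence the Cauchy--Schwarz inequality bounds
  \<open>\<pi>\<close> with respect to \<^const>\<open>free_norm_circ\<close>, and spreading each \<open>x\<^sup>k\<close>
  over its words proportionally to the conjugate coefficients gives a linear section of \<open>\<pi>\<close> that is isometric for this norm. This yields the
  quotient norm and the complement of the kernel. Modulo the relations every word is a multiple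
  of its sorted form, so the homogeneous components of an element of the kernel lie in the ideal;
  the element itself is the limit of its truncations.
\<close>

section \<open>Spaces of coefficient families with a scale of norms\<close>

text \<open>The projection sends a word to a multiple of one monomial, so it splits into one linear
  functional for each block of words with common letter counts, and \<open>free_norm_circ\<close> is
  a weighted l1 sum of the Euclidean norms of these blocks. This is why the quotient norm can be
  computed block by block and at a fixed radius. The topology, however, is given by
  \<open>free_norm\<close>, which mixes all blocks of one degree \<open>d\<close>. Passing between
  the two scales costs the number of blocks, at most \<open>(d + 1) ^ n\<close>, and this factor is
  absorbed by enlarging the radius; continuity estimates therefore lose radius. One bilinear form
  governs the algebra: \<open>reorder_exp\<close> is the exponent in the product of two monomials
  and also the number of inversions that a concatenation creates between its two parts. It makes the
  projection multiplicative, drives the recursion behind the multinomial identity, and records the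
  powers of \<open>q\<close> produced by sorting. The identity is applied with
  \<open>t = |q|^2\<close>, because Euclidean norms see the squared moduli of the
  coefficients.\<close>

locale function_norms =
  fixes A :: "('i \<Rightarrow> complex) set" and P :: "real set"
    and p :: "real \<Rightarrow> ('i \<Rightarrow> complex) \<Rightarrow> real"
  assumes radii_nonempty: "P \<noteq> {}"
    and zero_mem: "(\<lambda>i. 0) \<in> A"
    and add_mem: "\<And>a b. a \<in> A \<Longrightarrow> b \<in> A \<Longrightarrow> (\<lambda>i. a i + b i) \<in> A"
    and scale_mem: "\<And>a c. a \<in> A \<Longrightarrow> (\<lambda>i. c * a i) \<in> A"
    and norm_triangle:
      "\<And>\<rho> a b. \<rho> \<in> P \<Longrightarrow> a \<in> A \<Longrightarrow> b \<in> A \<Longrightarrow> p \<rho> (\<lambda>i. a i + b i) \<le> p \<rho> a + p \<rho> b"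
    and norm_minus: "\<And>\<rho> a. \<rho> \<in> P \<Longrightarrow> a \<in> A \<Longrightarrow> p \<rho> (\<lambda>i. - a i) = p \<rho> a"
    and norm_nonneg: "\<And>\<rho> a. \<rho> \<in> P \<Longrightarrow> a \<in> A \<Longrightarrow> 0 \<le> p \<rho> a"
    and norm_eq_0_iff: "\<And>\<rho> a. \<rho> \<in> P \<Longrightarrow> a \<in> A \<Longrightarrow> p \<rho> a = 0 \<longleftrightarrow> a = (\<lambda>i. 0)"
    and norm_mono: "\<And>\<rho> \<rho>' a. \<rho> \<in> P \<Longrightarrow> \<rho>' \<in> P \<Longrightarrow> \<rho> \<le> \<rho>' \<Longrightarrow> a \<in> A \<Longrightarrow> p \<rho> a \<le> p \<rho>' a"
begin

abbreviation T where "T \<equiv> norms_topology A P p"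

lemma minus_mem: "a \<in> A \<Longrightarrow> (\<lambda>i. - a i) \<in> A"
  using scale_mem[of a "-1"] by simp

lemma diff_mem: "a \<in> A \<Longrightarrow> b \<in> A \<Longrightarrow> (\<lambda>i. a i - b i) \<in> A"
  using add_mem[of a "\<lambda>i. - b i"] minus_mem[of b] by simp

lemma norm_diff_triangle:
  assumes "\<rho> \<in> P" "a \<in> A" "b \<in> A" "c \<in> A"
  shows "p \<rho> (\<lambda>i. a i - c i) \<le> p \<rho> (\<lambda>i. a i - b i) + p \<rho> (\<lambda>i. b i - c i)"
  using norm_triangle[OF assms(1) diff_mem[OF assms(2,3)] diff_mem[OF assms(3,4)]] by simp

lemma topspace_norms_topology: "topspace T = A"
proof -
  obtain \<rho> where "\<rho> \<in> P" using radii_nonempty by blast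
  then have "a \<in> \<Union> {{b \<in> A. p \<rho> (\<lambda>i. b i - a i) < \<epsilon>} | a \<rho> \<epsilon>. a \<in> A \<and> \<rho> \<in> P \<and> 0 < \<epsilon>}"
    if "a \<in> A" for a
    using that norm_eq_0_iff[OF _ zero_mem]
    by (intro UnionI[of "{b \<in> A. p \<rho> (\<lambda>i. b i - a i) < 1}"]) force+
  then show ?thesis
    unfolding norms_topology_def topology_generated_by_topspace by blast
qed

lemma openin_ball:
  assumes "a \<in> A" "\<rho> \<in> P" "0 < \<epsilon>"
  shows "openin T {b \<in> A. p \<rho> (\<lambda>i. b i - a i) < \<epsilon>}"
  unfolding norms_topology_def using assms by (intro topology_generated_by_Basis) blast

lemma ball_centre:
  assumes "a \<in> A" "\<rho> \<in> P" "0 < \<epsilon>"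
  shows "a \<in> {b \<in> A. p \<rho> (\<lambda>i. b i - a i) < \<epsilon>}"
  using assms norm_eq_0_iff[OF assms(2) zero_mem] by simp

text \<open>The norms increase with the radius, so two balls around one centre contain the ball for
  the larger radius and the smaller bound. After recentring by the triangle inequality, the given
  subbase is therefore a base.\<close>

lemma openin_norms_topology:
  "openin T U \<longleftrightarrow> U \<subseteq> A \<and>
     (\<forall>a\<in>U. \<exists>\<rho>\<in>P. \<exists>\<epsilon>>0. {b \<in> A. p \<rho> (\<lambda>i. b i - a i) < \<epsilon>} \<subseteq> U)" (is "_ \<longleftrightarrow> ?R U")
proof
  assume "openin T U"
  then have "generate_topology_on
      {{b \<in> A. p \<rho> (\<lambda>i. b i - a i) < \<epsilon>} | a \<rho> \<epsilon>. a \<in> A \<and> \<rho> \<in> P \<and> 0 < \<epsilon>} U"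
    unfolding norms_topology_def by (simp add: openin_topology_generated_by_iff)
  then show "?R U"
  proof induction
    case Empty
    then show ?case by simp
  next
    case (Int U V)
    have "\<exists>\<rho>\<in>P. \<exists>\<epsilon>>0. {b \<in> A. p \<rho> (\<lambda>i. b i - a i) < \<epsilon>} \<subseteq> U \<inter> V" if a: "a \<in> U" "a \<in> V" for a
    proof -
      have aA: "a \<in> A" using a Int by blast
      obtain \<rho> \<epsilon> where 1: "\<rho> \<in> P" "0 < \<epsilon>" "{b \<in> A. p \<rho> (\<lambda>i. b i - a i) < \<epsilon>} \<subseteq> U"
        using a Int by meson
      obtain \<rho>' \<epsilon>' where 2: "\<rho>' \<in> P" "0 < \<epsilon>'" "{b \<in> A. p \<rho>' (\<lambda>i. b i - a i) < \<epsilon>'} \<subseteq> V"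
        using a Int by meson
      have m: "max \<rho> \<rho>' \<in> P" using 1 2 by (simp add: max_def)
      have "{b \<in> A. p (max \<rho> \<rho>') (\<lambda>i. b i - a i) < min \<epsilon> \<epsilon>'} \<subseteq> U \<inter> V"
      proof
        fix b assume b: "b \<in> {b \<in> A. p (max \<rho> \<rho>') (\<lambda>i. b i - a i) < min \<epsilon> \<epsilon>'}"
        then have "p \<rho> (\<lambda>i. b i - a i) < \<epsilon>" "p \<rho>' (\<lambda>i. b i - a i) < \<epsilon>'"
          using norm_mono[OF 1(1) m _ diff_mem[of b a]] norm_mono[OF 2(1) m _ diff_mem[of b a]] aA
          by auto
        then show "b \<in> U \<inter> V" using b 1 2 by blast
      qed
      moreover have "0 < min \<epsilon> \<epsilon>'" using 1 2 by simp
      ultimately show ?thesis using m by blast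
    qed
    then show ?case using Int by blast
  next
    case (UN K)
    then show ?case by (meson Sup_least UnionE Union_upper subset_trans)
  next
    case (Basis s)
    then obtain a \<rho> \<epsilon> where s: "s = {b \<in> A. p \<rho> (\<lambda>i. b i - a i) < \<epsilon>}" "a \<in> A" "\<rho> \<in> P" "0 < \<epsilon>"
      by blast
    have "{b \<in> A. p \<rho> (\<lambda>i. b i - c i) < \<epsilon> - p \<rho> (\<lambda>i. c i - a i)} \<subseteq> s" if "c \<in> s" for c
      using that norm_diff_triangle[OF s(3) _ _ s(2), of _ c] by (force simp: s(1))
    then show ?case
      using s by (auto intro!: bexI[of _ \<rho>] exI[of _ "\<epsilon> - p \<rho> (\<lambda>i. c i - a i)" for c])
  qed
next
  assume R: "?R U"
  show "openin T U"
  proof (subst openin_subopen, intro ballI)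
    fix a assume a: "a \<in> U"
    then obtain \<rho> \<epsilon> where "\<rho> \<in> P" "0 < \<epsilon>" "{b \<in> A. p \<rho> (\<lambda>i. b i - a i) < \<epsilon>} \<subseteq> U"
      using R by meson
    then show "\<exists>V. openin T V \<and> a \<in> V \<and> V \<subseteq> U"
      using openin_ball[of a \<rho> \<epsilon>] ball_centre[of a \<rho> \<epsilon>] a R by blast
  qed
qed

text \<open>Approximation in one norm at a time suffices, because balls of single norms form a
  neighbourhood base. This is the form in which truncations are used.\<close>

lemma closedin_mem:
  assumes "closedin T I" "a \<in> A"
    and "\<And>\<rho> \<epsilon>. \<rho> \<in> P \<Longrightarrow> 0 < \<epsilon> \<Longrightarrow> \<exists>b\<in>I. p \<rho> (\<lambda>i. b i - a i) < \<epsilon>"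
  shows "a \<in> I"
proof (rule ccontr)
  assume "a \<notin> I"
  moreover have "openin T (A - I)" "I \<subseteq> A"
    using assms(1) topspace_norms_topology by (auto simp: closedin_def)
  ultimately obtain \<rho> \<epsilon> where "\<rho> \<in> P" "0 < \<epsilon>" "{b \<in> A. p \<rho> (\<lambda>i. b i - a i) < \<epsilon>} \<subseteq> A - I"
    using assms(2) by (force simp: openin_norms_topology)
  with assms(3)[of \<rho> \<epsilon>] \<open>I \<subseteq> A\<close> show False by blast
qed

text \<open>Each \<open>p \<rho>\<close> is a norm and not merely a seminorm, so the ball of radius
  \<open>p \<rho> a\<close> around a nonzero \<open>a\<close> misses zero. Preimages of this
  singleton yield the closedness of the kernel and of its complement.\<close>

lemma closedin_zero: "closedin T {\<lambda>i. 0}"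
proof -
  obtain \<rho> where \<rho>: "\<rho> \<in> P" using radii_nonempty by blast
  have "(\<lambda>i. 0) \<notin> {b \<in> A. p \<rho> (\<lambda>i. b i - a i) < p \<rho> a} \<and> 0 < p \<rho> a"
    if "a \<in> A" "a \<noteq> (\<lambda>i. 0)" for a
    using that \<rho> norm_minus[OF \<rho> that(1)] norm_nonneg[OF \<rho> that(1)] norm_eq_0_iff[OF \<rho> that(1)]
    by auto
  then have "openin T (A - {\<lambda>i. 0})"
    unfolding openin_norms_topology using \<rho> by blast
  then show ?thesis
    by (simp add: closedin_def topspace_norms_topology zero_mem)
qed

text \<open>The forward half of the homeomorphism that a topological complement requires; each
  summand receives half of the bound.\<close>

lemma continuous_map_add:
  "continuous_map (prod_topology T T) T (\<lambda>(a, b). (\<lambda>i. a i + b i))"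
proof -
  have "openin (prod_topology T T) {x \<in> topspace (prod_topology T T). (case x of (a, b) \<Rightarrow> \<lambda>i. a i + b i) \<in> U}"
    if U: "openin T U" for U
    unfolding openin_prod_topology_alt
  proof (intro allI impI)
    fix a b
    assume "(a, b) \<in> {x \<in> topspace (prod_topology T T). (case x of (a, b) \<Rightarrow> \<lambda>i. a i + b i) \<in> U}"
    then have ab: "a \<in> A" "b \<in> A" "(\<lambda>i. a i + b i) \<in> U"
      by (auto simp: topspace_norms_topology)
    then obtain \<rho> \<epsilon> where \<rho>: "\<rho> \<in> P" "0 < \<epsilon>" "{c \<in> A. p \<rho> (\<lambda>i. c i - (a i + b i)) < \<epsilon>} \<subseteq> U"
      using U unfolding openin_norms_topology by meson
    let ?B = "\<lambda>a. {c \<in> A. p \<rho> (\<lambda>i. c i - a i) < \<epsilon> / 2}"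
    have "(\<lambda>i. c i + d i) \<in> U" if "c \<in> ?B a" "d \<in> ?B b" for c d
    proof -
      have "p \<rho> (\<lambda>i. (c i - a i) + (d i - b i)) < \<epsilon>"
        using norm_triangle[OF \<rho>(1) diff_mem[of c a] diff_mem[of d b]] that ab by auto
      then show ?thesis
        using \<rho>(3) that by (auto simp: add_mem algebra_simps intro!: subsetD[OF \<rho>(3)])
    qed
    then have "?B a \<times> ?B b \<subseteq>
        {x \<in> topspace (prod_topology T T). (case x of (a, b) \<Rightarrow> \<lambda>i. a i + b i) \<in> U}"
      by (auto simp: topspace_norms_topology)
    moreover have "openin T (?B a)" "openin T (?B b)" "a \<in> ?B a" "b \<in> ?B b"
      using openin_ball[of _ \<rho> "\<epsilon> / 2"] ball_centre[of _ \<rho> "\<epsilon> / 2"] ab \<rho> half_gt_zero by blast+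
    ultimately show "\<exists>V W. openin T V \<and> openin T W \<and> a \<in> V \<and> b \<in> W \<and> V \<times> W \<subseteq>
        {x \<in> topspace (prod_topology T T). (case x of (a, b) \<Rightarrow> \<lambda>i. a i + b i) \<in> U}"
      by blast
  qed
  then show ?thesis
    by (auto simp: continuous_map_def topspace_norms_topology add_mem)
qed

end

text \<open>Continuity at \<open>a\<close> is the bound applied to a difference
  \<open>b - a\<close>. The radius on the source may differ from \<open>\<sigma>\<close>, which
  leaves room for estimates that lose radius.\<close>

lemma continuous_map_of_norm_bound:
  assumes "function_norms A P p" "function_norms B Q s"
    and maps: "\<And>a. a \<in> A \<Longrightarrow> h a \<in> B"
    and diff: "\<And>a b. a \<in> A \<Longrightarrow> b \<in> A \<Longrightarrow> h (\<lambda>i. a i - b i) = (\<lambda>i. h a i - h b i)"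
    and bound: "\<And>\<sigma>. \<sigma> \<in> Q \<Longrightarrow> \<exists>\<rho>\<in>P. \<exists>C>0. \<forall>a\<in>A. s \<sigma> (h a) \<le> C * p \<rho> a"
  shows "continuous_map (norms_topology A P p) (norms_topology B Q s) h"
proof -
  interpret A: function_norms A P p by fact
  interpret B: function_norms B Q s by fact
  have "openin A.T {a \<in> A. h a \<in> U}" if U: "openin B.T U" for U
    unfolding A.openin_norms_topology
  proof (intro conjI ballI)
    fix a assume "a \<in> {a \<in> A. h a \<in> U}"
    then have a: "a \<in> A" "h a \<in> U" by auto
    then obtain \<sigma> \<epsilon> where \<sigma>: "\<sigma> \<in> Q" "0 < \<epsilon>" "{c \<in> B. s \<sigma> (\<lambda>i. c i - h a i) < \<epsilon>} \<subseteq> U"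
      using U unfolding B.openin_norms_topology by meson
    obtain \<rho> C where \<rho>: "\<rho> \<in> P" "0 < C" "\<And>a. a \<in> A \<Longrightarrow> s \<sigma> (h a) \<le> C * p \<rho> a"
      using bound[OF \<sigma>(1)] by blast
    have "{b \<in> A. p \<rho> (\<lambda>i. b i - a i) < \<epsilon> / C} \<subseteq> {a \<in> A. h a \<in> U}"
    proof clarify
      fix b assume b: "b \<in> A" "p \<rho> (\<lambda>i. b i - a i) < \<epsilon> / C"
      then have "s \<sigma> (\<lambda>i. h b i - h a i) < \<epsilon>"
        using \<rho>(3)[OF A.diff_mem[OF b(1) a(1)]] \<rho>(2) diff[OF b(1) a(1)]
        by (simp add: field_simps)
      then show "h b \<in> U" using \<sigma>(3) maps[OF b(1)] by blast
    qed
    then show "\<exists>\<rho>\<in>P. \<exists>\<epsilon>>0. {b \<in> A. p \<rho> (\<lambda>i. b i - a i) < \<epsilon>} \<subseteq> {a \<in> A. h a \<in> U}"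
      using \<rho> \<sigma> by (intro bexI[of _ \<rho>] exI[of _ "\<epsilon> / C"]) auto
  qed auto
  then show ?thesis
    by (auto simp: continuous_map_def A.topspace_norms_topology B.topspace_norms_topology maps)
qed

section \<open>Words, inversions and the weights\<close>

definition letter :: "nat \<Rightarrow> nat \<Rightarrow> nat" where
  "letter i = (\<lambda>j. if j = i then 1 else 0)"

lemma letter_counts_Nil: "letter_counts [] = (\<lambda>_. 0)"
  by (simp add: letter_counts_def)

lemma letter_counts_Cons: "letter_counts (i # w) = (\<lambda>j. letter i j + letter_counts w j)"
  by (auto simp: letter_counts_def letter_def)

lemma letter_counts_append: "letter_counts (u @ v) = (\<lambda>i. letter_counts u i + letter_counts v i)"
  by (auto simp: letter_counts_def)

lemma words_Nil: "[] \<in> words n"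
  by (simp add: words_def)

lemma words_Cons: "i # w \<in> words n \<longleftrightarrow> i \<in> {1..n} \<and> w \<in> words n"
  by (auto simp: words_def)

lemma words_append: "u @ v \<in> words n \<longleftrightarrow> u \<in> words n \<and> v \<in> words n"
  by (auto simp: words_def)

lemma letter_counts_mem: "w \<in> words n \<Longrightarrow> letter_counts w \<in> multi_indices n"
  by (auto simp: words_def multi_indices_def letter_counts_def count_list_0_iff)

lemma multi_size_add: "multi_size n (\<lambda>i. k i + l i) = multi_size n k + multi_size n l"
  by (simp add: multi_size_def sum.distrib)

lemma multi_size_letter: "i \<in> {1..n} \<Longrightarrow> multi_size n (letter i) = 1"
  by (simp add: multi_size_def letter_def)

lemma multi_size_letter_counts: "w \<in> words n \<Longrightarrow> multi_size n (letter_counts w) = length w"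
proof (induction w)
  case Nil
  then show ?case by (simp add: letter_counts_Nil multi_size_def)
next
  case (Cons i w)
  then show ?case
    by (simp add: words_Cons letter_counts_Cons multi_size_add multi_size_letter)
qed

lemma finite_words_len: "finite (words_len n d)"
  unfolding words_len_def words_def
  using finite_lists_length_eq[of "{1..n}" d] by (auto elim!: rev_finite_subset)

lemma words_of_counts_subset: "words_of_counts n k \<subseteq> words_len n (multi_size n k)"
  by (auto simp: words_of_counts_def words_len_def multi_size_letter_counts)

lemma finite_words_of_counts: "finite (words_of_counts n k)"
  using finite_subset[OF words_of_counts_subset finite_words_len] .

lemma words_of_counts_empty: "k \<notin> multi_indices n \<Longrightarrow> words_of_counts n k = {}"
  by (auto simp: words_of_counts_def letter_counts_mem)

definition multi_indices_of_size :: "nat \<Rightarrow> nat \<Rightarrow> (nat \<Rightarrow> nat) set" where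
  "multi_indices_of_size n d = {k \<in> multi_indices n. multi_size n k = d}"

text \<open>Each entry of a multi-index of size \<open>d\<close> lies in \<open>{..d}\<close>. The
  bound is crude, but any polynomial growth in \<open>d\<close> can be absorbed by a larger
  radius.\<close>

lemma card_multi_indices_of_size:
  shows finite_multi_indices_of_size: "finite (multi_indices_of_size n d)"
    and "card (multi_indices_of_size n d) \<le> (d + 1) ^ n"
proof -
  \<comment> \<open>Multi-indices vanish outside \<open>{1..n}\<close>, whereas extensional
    functions are \<open>undefined\<close> there; restriction translates between the two
    conventions.\<close>
  let ?r = "\<lambda>k::nat \<Rightarrow> nat. restrict k {1..n}"
  have inj: "inj_on ?r (multi_indices_of_size n d)"
  proof (rule inj_onI, rule ext)
    fix k l i assume "k \<in> multi_indices_of_size n d" "l \<in> multi_indices_of_size n d" "?r k = ?r l"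
    then show "k i = l i"
      by (cases "i \<in> {1..n}")
         (metis restrict_apply, auto simp: multi_indices_of_size_def multi_indices_def)
  qed
  have sub: "?r ` multi_indices_of_size n d \<subseteq> {1..n} \<rightarrow>\<^sub>E {..d}"
  proof clarify
    fix k assume k: "k \<in> multi_indices_of_size n d"
    have "k i \<le> d" if "i \<in> {1..n}" for i
      using k member_le_sum[of i "{1..n}" k] that
      by (simp add: multi_indices_of_size_def multi_size_def)
    then show "?r k \<in> {1..n} \<rightarrow>\<^sub>E {..d}" by auto
  qed
  have fin: "finite ({1..n} \<rightarrow>\<^sub>E {..d})" by (simp add: finite_PiE)
  show "finite (multi_indices_of_size n d)"
    using inj_on_finite[OF inj sub fin] .
  show "card (multi_indices_of_size n d) \<le> (d + 1) ^ n"
    using card_inj_on_le[OF inj sub fin] by (simp add: card_PiE)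
qed

lemma words_len_eq_Union:
  "words_len n d = (\<Union>k\<in>multi_indices_of_size n d. words_of_counts n k)"
  by (auto simp: words_len_def words_of_counts_def multi_indices_of_size_def
      letter_counts_mem multi_size_letter_counts)

lemma sum_words_len:
  "(\<Sum>w\<in>words_len n d. f w) = (\<Sum>k\<in>multi_indices_of_size n d. \<Sum>w\<in>words_of_counts n k. f w)"
  unfolding words_len_eq_Union
  by (rule sum.UNION_disjoint)
     (use finite_words_of_counts in \<open>auto simp: finite_multi_indices_of_size words_of_counts_def\<close>)

lemma reorder_exp_zero: "reorder_exp n (\<lambda>_. 0) k = 0" "reorder_exp n k (\<lambda>_. 0) = 0"
  by (simp_all add: reorder_exp_def)

text \<open>A letter in front of a word forms an inversion with each smaller letter of it; a letter
  behind the word does so with each larger one (\<open>reorder_exp_letter_right\<close>).\<close>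

lemma reorder_exp_letter_left:
  assumes "i \<in> {1..n}"
  shows "reorder_exp n (letter i) k = (\<Sum>j=1..<i. k j)"
proof -
  have "reorder_exp n (letter i) k = (\<Sum>b=1..n. if b = i then \<Sum>a=1..<b. k a else 0)"
    unfolding reorder_exp_def letter_def by (intro sum.cong) auto
  then show ?thesis using assms by simp
qed

lemma reorder_exp_letter_right:
  assumes "i \<in> {1..n}"
  shows "reorder_exp n k (letter i) = (\<Sum>j\<in>{i<..n}. k j)"
proof -
  have "(\<Sum>a=1..<j. k j * letter i a) = (if j \<in> {i<..n} then k j else 0)" if "j \<in> {1..n}" for j
  proof -
    have "(\<Sum>a=1..<j. k j * letter i a) = (\<Sum>a=1..<j. if a = i then k j else 0)"
      by (intro sum.cong) (auto simp: letter_def)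
    then show ?thesis using that assms by auto
  qed
  then have "reorder_exp n k (letter i) = (\<Sum>j=1..n. if j \<in> {i<..n} then k j else 0)"
    unfolding reorder_exp_def by (intro sum.cong) auto
  also have "\<dots> = (\<Sum>j\<in>{i<..n}. k j)"
    using assms by (simp add: sum.If_cases) (rule sum.cong, auto)
  finally show ?thesis .
qed

text \<open>The number of inversions of a word, written through the bilinear form
  \<^const>\<open>reorder_exp\<close> so that its behaviour under concatenation is immediate.\<close>

primrec inversions :: "nat \<Rightarrow> nat list \<Rightarrow> nat" where
  "inversions n [] = 0"
| "inversions n (i # w) = reorder_exp n (letter i) (letter_counts w) + inversions n w"

text \<open>The cocycle identity that makes the projection multiplicative: the extra term is the
  exponent in the product of the two monomials.\<close>

lemma inversions_append:
  "inversions n (u @ v) =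
     inversions n u + inversions n v + reorder_exp n (letter_counts u) (letter_counts v)"
  by (induction u)
     (simp_all add: letter_counts_Nil letter_counts_Cons letter_counts_append reorder_exp_add reorder_exp_zero)

text \<open>Classification by the first letter. The condition \<open>0 < k i\<close> guards the
  truncated subtraction, which would otherwise leave \<open>k\<close> unchanged at
  \<open>i\<close>.\<close>

lemma words_of_counts_Suc:
  assumes "k \<in> multi_indices n" "multi_size n k \<noteq> 0"
  shows "words_of_counts n k =
    (\<Union>i\<in>{i\<in>{1..n}. 0 < k i}. (#) i ` words_of_counts n (\<lambda>j. k j - letter i j))"
proof (intro Set.set_eqI iffI)
  fix w assume w: "w \<in> words_of_counts n k"
  then obtain i v where [simp]: "w = i # v"
    using assms(2) by (cases w) (auto simp: words_of_counts_def letter_counts_Nil multi_size_def)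
  have "i \<in> {1..n}" "v \<in> words n" "k = (\<lambda>j. letter i j + letter_counts v j)"
    using w by (auto simp: words_of_counts_def words_Cons letter_counts_Cons)
  then show "w \<in> (\<Union>i\<in>{i\<in>{1..n}. 0 < k i}. (#) i ` words_of_counts n (\<lambda>j. k j - letter i j))"
    by (auto simp: words_of_counts_def letter_def)
next
  fix w assume "w \<in> (\<Union>i\<in>{i\<in>{1..n}. 0 < k i}. (#) i ` words_of_counts n (\<lambda>j. k j - letter i j))"
  then obtain i v where [simp]: "w = i # v" and
    iv: "i \<in> {1..n}" "0 < k i" "v \<in> words n" "letter_counts v = (\<lambda>j. k j - letter i j)"
    by (auto simp: words_of_counts_def)
  have "(\<lambda>j. letter i j + (k j - letter i j)) = k"
    using iv(2) by (auto simp: letter_def)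
  then show "w \<in> words_of_counts n k"
    using iv by (simp add: words_of_counts_def words_Cons letter_counts_Cons)
qed

section \<open>Gaussian integers and factorials\<close>

lemma q_int_add: "q_int t (a + b) = q_int t b + t ^ b * q_int t a"
proof -
  have "q_int t (b + a) = q_int t b + t ^ b * q_int t a"
    unfolding q_int_def by (induction a) (simp_all add: algebra_simps power_add)
  then show ?thesis by (simp add: add.commute)
qed

text \<open>A geometric sum with \<open>k 1 + ... + k m\<close> terms is cut into blocks of lengths
  \<open>k i\<close>; the block of index \<open>i\<close> starts after the blocks of all larger
  indices, whence the power of \<open>t\<close>.\<close>

lemma q_int_sum:
  fixes m :: nat
  shows "(\<Sum>i=1..m. t ^ (\<Sum>j\<in>{i<..m}. k j) * q_int t (k i)) = q_int t (\<Sum>i=1..m. k i)"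
proof (induction m)
  case 0
  then show ?case by (simp add: q_int_def)
next
  case (Suc m)
  have "(\<Sum>j\<in>{i<..Suc m}. k j) = k (Suc m) + (\<Sum>j\<in>{i<..m}. k j)" if "i \<in> {1..m}" for i
  proof -
    have "{i<..Suc m} = insert (Suc m) {i<..m}" using that by auto
    then show ?thesis by simp
  qed
  then have "(\<Sum>i=1..m. t ^ (\<Sum>j\<in>{i<..Suc m}. k j) * q_int t (k i)) =
      t ^ k (Suc m) * (\<Sum>i=1..m. t ^ (\<Sum>j\<in>{i<..m}. k j) * q_int t (k i))"
    unfolding sum_distrib_left by (intro sum.cong) (auto simp: power_add)
  then show ?case
    using Suc q_int_add[of t "\<Sum>i=1..m. k i" "k (Suc m)"] by simp
qed

lemma q_fact_Suc: "q_fact t (Suc m) = q_fact t m * q_int t (Suc m)"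
  by (simp add: q_fact_def)

lemma q_fact_pos: "0 < t \<Longrightarrow> 0 < q_fact t m"
  unfolding q_fact_def q_int_def by (intro prod_pos ballI sum_pos) (auto simp: lessThan_empty_iff)

lemma q_fact_multi_pos: "0 < t \<Longrightarrow> 0 < q_fact_multi t n k"
  unfolding q_fact_multi_def by (intro prod_pos ballI q_fact_pos)

lemma q_fact_multi_add_letter:
  assumes "i \<in> {1..n}"
  shows "q_fact_multi t n (\<lambda>j. k j + letter i j) = q_fact_multi t n k * q_int t (Suc (k i))"
proof -
  have "q_fact_multi t n (\<lambda>j. k j + letter i j) =
      (\<Prod>j=1..n. q_fact t (k j) * (if j = i then q_int t (Suc (k i)) else 1))"
    unfolding q_fact_multi_def by (intro prod.cong) (auto simp: letter_def q_fact_Suc)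
  then show ?thesis
    using assms by (simp add: prod.distrib q_fact_multi_def)
qed

text \<open>The \<open>q\<close>-multinomial theorem of MacMahon: split off the first letter of each word.\<close>

lemma sum_inversions:
  assumes "0 < t" "k \<in> multi_indices n"
  shows "(\<Sum>w\<in>words_of_counts n k. inverse t ^ inversions n w) *
      t ^ reorder_exp n k k * q_fact_multi t n k = q_fact t (multi_size n k)"
  using assms(2)
proof (induction "multi_size n k" arbitrary: k)
  case 0
  then have k: "k = (\<lambda>_. 0)"
    by (force simp: multi_size_def multi_indices_def fun_eq_iff)
  have "words_of_counts n k = {[]}"
  proof -
    have "w = []" if "w \<in> words_of_counts n k" for w
      using that words_of_counts_subset[of n k] 0(1) by (auto simp: words_len_def)
    then show ?thesis by (auto simp: words_of_counts_def letter_counts_Nil k words_Nil)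
  qed
  then show ?case
    by (simp add: k reorder_exp_zero q_fact_multi_def multi_size_def q_fact_def)
next
  case (Suc d)
  let ?N = "\<lambda>k. \<Sum>w\<in>words_of_counts n k. inverse t ^ inversions n w"
  let ?I = "{i\<in>{1..n}. 0 < k i}"
  let ?W = "\<lambda>i. (#) i ` words_of_counts n (\<lambda>j. k j - letter i j)"
  have "multi_size n k \<noteq> 0" using Suc(2) by simp
  note decomp = words_of_counts_Suc[OF Suc(3) this]
  have "?N k = (\<Sum>i\<in>?I. \<Sum>w\<in>?W i. inverse t ^ inversions n w)"
    by (subst decomp, intro sum.UNION_disjoint) (auto simp: finite_words_of_counts)
  then have "?N k * t ^ reorder_exp n k k * q_fact_multi t n k =
      (\<Sum>i\<in>?I. (\<Sum>w\<in>?W i. inverse t ^ inversions n w) * t ^ reorder_exp n k k * q_fact_multi t n k)"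
    by (simp add: sum_distrib_right)
  also have "\<dots> = (\<Sum>i\<in>?I. t ^ (\<Sum>j\<in>{i<..n}. k j) * q_int t (k i) * q_fact t d)"
  proof (rule sum.cong[OF refl])
    fix i assume "i \<in> ?I"
    then have i: "i \<in> {1..n}" "0 < k i" by auto
    define l where "l = (\<lambda>j. k j - letter i j)"
    have k: "k = (\<lambda>j. l j + letter i j)" and li: "Suc (l i) = k i"
      using i(2) by (auto simp: l_def letter_def)
    have l: "l \<in> multi_indices n" "multi_size n l = d"
      using Suc(2,3) i(1) multi_size_letter[OF i(1)] unfolding k
      by (auto simp: multi_indices_add_iff multi_size_add)
    have kl: "(\<Sum>j\<in>{i<..n}. k j) = reorder_exp n l (letter i)"
      unfolding reorder_exp_letter_right[OF i(1)] k by (intro sum.cong) (auto simp: letter_def)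
    have "reorder_exp n (letter i) (letter i) = 0"
      unfolding reorder_exp_letter_left[OF i(1)] by (simp add: letter_def)
    \<comment> \<open>Expanding the form at \<open>l + letter i\<close> leaves two cross terms. The
      one with \<open>letter i\<close> on the left cancels the inversions caused by the leading
      letter; the other is the exponent that \<open>q_int_sum\<close> expects.\<close>
    then have R: "reorder_exp n k k =
        reorder_exp n l l + reorder_exp n l (letter i) + reorder_exp n (letter i) l"
      unfolding k reorder_exp_add by simp
    have "(\<Sum>w\<in>?W i. inverse t ^ inversions n w) =
        inverse t ^ reorder_exp n (letter i) l * ?N l"
      unfolding l_def[symmetric]
      by (subst sum.reindex) (auto simp: sum_distrib_left power_add words_of_counts_def)
    moreover have "q_fact_multi t n k = q_fact_multi t n l * q_int t (k i)"
      unfolding li[symmetric] by (subst k) (rule q_fact_multi_add_letter[OF i(1)])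
    ultimately have "(\<Sum>w\<in>?W i. inverse t ^ inversions n w) * t ^ reorder_exp n k k * q_fact_multi t n k =
        (inverse t * t) ^ reorder_exp n (letter i) l * t ^ (\<Sum>j\<in>{i<..n}. k j) * q_int t (k i) *
          (?N l * t ^ reorder_exp n l l * q_fact_multi t n l)"
      unfolding R kl power_add power_mult_distrib by (simp only: mult_ac)
    also have "\<dots> = t ^ (\<Sum>j\<in>{i<..n}. k j) * q_int t (k i) * q_fact t d"
      using Suc(1)[of l] l assms(1) by simp
    finally show "(\<Sum>w\<in>?W i. inverse t ^ inversions n w) * t ^ reorder_exp n k k * q_fact_multi t n k =
        t ^ (\<Sum>j\<in>{i<..n}. k j) * q_int t (k i) * q_fact t d" .
  qed
  \<comment> \<open>Letters with \<open>k i = 0\<close> contribute \<open>q_int t 0 = 0\<close>, so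
    the sum may run over all of \<open>{1..n}\<close>.\<close>
  also have "\<dots> = (\<Sum>i=1..n. t ^ (\<Sum>j\<in>{i<..n}. k j) * q_int t (k i) * q_fact t d)"
    by (intro sum.mono_neutral_left) (auto simp: q_int_def)
  also have "\<dots> = q_int t (multi_size n k) * q_fact t d"
    using q_int_sum[where t = t and k = k and m = n] by (simp add: multi_size_def flip: sum_distrib_right)
  finally show ?case
    by (simp add: q_fact_Suc flip: Suc(2))
qed

section \<open>Weights of the quantum ball norms\<close>

lemma quantum_weight_nonneg: "0 \<le> quantum_weight q n k"
proof -
  have "0 \<le> q_fact ((cmod q)\<^sup>2) m" for m
    unfolding q_fact_def q_int_def by (intro prod_nonneg ballI sum_nonneg) auto
  then show ?thesis
    unfolding quantum_weight_def u_weight_def q_fact_multi_def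
    by (intro mult_nonneg_nonneg real_sqrt_ge_zero divide_nonneg_nonneg prod_nonneg ballI) auto
qed

text \<open>With \<open>t = |q|^2\<close> the summands become
  \<open>inverse t ^ inversions n w\<close>, and the exponent in \<open>u_weight\<close> is the
  diagonal value \<open>reorder_exp n k k\<close>. The claim is then \<open>sum_inversions\<close>
  divided by \<open>q_fact t (multi_size n k)\<close>.\<close>

lemma quantum_weight_inversions:
  assumes "q \<noteq> 0" "k \<in> multi_indices n"
  shows "(quantum_weight q n k)\<^sup>2 *
    (\<Sum>w\<in>words_of_counts n k. (cmod (inverse q ^ inversions n w))\<^sup>2) = 1"
proof -
  let ?t = "(cmod q)\<^sup>2"
  have t: "0 < ?t" using assms by simp
  have c: "(cmod (inverse q ^ m))\<^sup>2 = inverse ?t ^ m" for m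
    by (simp add: norm_power norm_inverse power_inverse flip: power_mult) (simp add: mult.commute)
  have "(\<Sum>j=1..n. \<Sum>i=1..<j. k i * k j) = reorder_exp n k k"
    unfolding reorder_exp_def by (simp add: mult.commute)
  then have u: "(u_weight q n k)\<^sup>2 = ?t ^ reorder_exp n k k"
    unfolding u_weight_def by (simp add: mult.commute flip: power_mult)
  have "(quantum_weight q n k)\<^sup>2 = q_fact_multi ?t n k / q_fact ?t (multi_size n k) * ?t ^ reorder_exp n k k"
    unfolding quantum_weight_def power_mult_distrib u
    using q_fact_multi_pos[OF t, of n k] q_fact_pos[OF t, of "multi_size n k"] by simp
  then show ?thesis
    unfolding c using sum_inversions[OF t assms(2)] q_fact_pos[OF t, of "multi_size n k"]
    by (simp add: mult_ac)
qed

text \<open>A zero weight would make the product in \<open>quantum_weight_inversions\<close>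
  vanish.\<close>

lemma quantum_weight_pos:
  assumes "q \<noteq> 0" "k \<in> multi_indices n"
  shows "0 < quantum_weight q n k"
  using quantum_weight_inversions[OF assms] quantum_weight_nonneg[of q n k]
  by (cases "quantum_weight q n k = 0") auto

section \<open>The projection and its isometric section\<close>

lemma radii_pos: "\<rho> \<in> radii r \<Longrightarrow> 0 < \<rho>"
  by (simp add: radii_def)

text \<open>The open interval of radii has no largest element, for finite and infinite
  \<open>r\<close> alike, so an estimate may always move to a slightly larger radius.\<close>

lemma radii_larger:
  assumes "\<rho> \<in> radii r"
  obtains \<rho>' where "\<rho>' \<in> radii r" "\<rho> < \<rho>'"
proof -
  obtain \<rho>' where "ereal \<rho> < ereal \<rho>'" "ereal \<rho>' < r"
    using assms ereal_dense2[of "ereal \<rho>" r] by (auto simp: radii_def)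
  then show ?thesis using assms that[of \<rho>'] by (simp add: radii_def)
qed

lemma radii_nonempty_iff: "radii r \<noteq> {} \<longleftrightarrow> 0 < r"
proof
  assume "0 < r"
  then obtain \<rho> where "ereal 0 < ereal \<rho>" "ereal \<rho> < r"
    using ereal_dense2[of 0 r] by (auto simp: zero_ereal_def)
  then show "radii r \<noteq> {}" by (auto simp: radii_def)
next
  assume "radii r \<noteq> {}"
  then obtain \<rho> where "0 < ereal \<rho>" "ereal \<rho> < r" by (auto simp: radii_def)
  then show "0 < r" by (rule less_trans)
qed

section \<open>The scales of norms and their comparison\<close>

abbreviation degree_norm :: "nat \<Rightarrow> (nat list \<Rightarrow> complex) \<Rightarrow> nat \<Rightarrow> real" where
  "degree_norm n a d \<equiv> L2_set (\<lambda>w. cmod (a w)) (words_len n d)"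

abbreviation count_norm :: "nat \<Rightarrow> (nat list \<Rightarrow> complex) \<Rightarrow> (nat \<Rightarrow> nat) \<Rightarrow> real" where
  "count_norm n a k \<equiv> L2_set (\<lambda>w. cmod (a w)) (words_of_counts n k)"

lemma free_norm_eq: "free_norm n \<rho> a = (\<Sum>d. degree_norm n a d * \<rho> ^ d)"
  by (simp add: free_norm_def L2_set_def)

lemma free_norm_circ_eq:
  "free_norm_circ n \<rho> a = (\<Sum>\<^sub>\<infinity>k\<in>multi_indices n. count_norm n a k * \<rho> ^ multi_size n k)"
  by (simp add: free_norm_circ_def L2_set_def)

lemma free_ball_carrier_iff:
  "a \<in> free_ball_carrier n r \<longleftrightarrow> (\<forall>w. w \<notin> words n \<longrightarrow> a w = 0) \<and>
     (\<forall>\<rho> \<in> radii r. summable (\<lambda>d. degree_norm n a d * \<rho> ^ d))"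
  by (simp add: free_ball_carrier_def L2_set_def)

lemma L2_set_cmod_scale: "L2_set (\<lambda>w. cmod (c * a w)) S = cmod c * L2_set (\<lambda>w. cmod (a w)) S"
  by (simp add: norm_mult L2_set_right_distrib)

lemma L2_set_cmod_add:
  "L2_set (\<lambda>w. cmod (a w + b w)) S \<le> L2_set (\<lambda>w. cmod (a w)) S + L2_set (\<lambda>w. cmod (b w)) S"
  by (rule order_trans[OF L2_set_mono L2_set_triangle_ineq]) (auto intro: norm_triangle_ineq)

lemma function_norms_free_ball:
  assumes "0 < r"
  shows "function_norms (free_ball_carrier n r) (radii r) (free_norm n)"
proof
  show "radii r \<noteq> {}" using assms by (simp add: radii_nonempty_iff)
  show "(\<lambda>i. 0) \<in> free_ball_carrier n r"
    by (simp add: free_ball_carrier_iff L2_set_0')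
next
  fix a b assume a: "a \<in> free_ball_carrier n r" and b: "b \<in> free_ball_carrier n r"
  have le: "degree_norm n (\<lambda>i. a i + b i) d * \<rho> ^ d \<le> degree_norm n a d * \<rho> ^ d + degree_norm n b d * \<rho> ^ d"
    if "\<rho> \<in> radii r" for \<rho> d
    using mult_right_mono[OF L2_set_cmod_add[of a b "words_len n d"], of "\<rho> ^ d"] radii_pos[OF that]
    by (simp add: distrib_right)
  have sa: "summable (\<lambda>d. degree_norm n a d * \<rho> ^ d + degree_norm n b d * \<rho> ^ d)" if "\<rho> \<in> radii r" for \<rho>
    using a b that by (intro summable_add) (auto simp: free_ball_carrier_iff)
  have s: "summable (\<lambda>d. degree_norm n (\<lambda>i. a i + b i) d * \<rho> ^ d)" if "\<rho> \<in> radii r" for \<rho>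
    by (rule summable_comparison_test'[OF sa[OF that]]) (use le[OF that] radii_pos[OF that] in auto)
  show "(\<lambda>i. a i + b i) \<in> free_ball_carrier n r"
    using a b s by (auto simp: free_ball_carrier_iff)
  show "free_norm n \<rho> (\<lambda>i. a i + b i) \<le> free_norm n \<rho> a + free_norm n \<rho> b" if "\<rho> \<in> radii r" for \<rho>
  proof -
    have "free_norm n \<rho> (\<lambda>i. a i + b i) \<le> (\<Sum>d. degree_norm n a d * \<rho> ^ d + degree_norm n b d * \<rho> ^ d)"
      unfolding free_norm_eq using le s sa that by (intro suminf_le) auto
    also have "\<dots> = free_norm n \<rho> a + free_norm n \<rho> b"
      unfolding free_norm_eq using a b that by (intro suminf_add[symmetric]) (auto simp: free_ball_carrier_iff)
    finally show ?thesis .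
  qed
next
  fix a c assume a: "a \<in> free_ball_carrier n r"
  then show "(\<lambda>i. c * a i) \<in> free_ball_carrier n r"
    by (auto simp: free_ball_carrier_iff L2_set_cmod_scale mult.assoc intro: summable_mult)
next
  fix \<rho> a assume \<rho>: "\<rho> \<in> radii r" and a: "a \<in> free_ball_carrier n r"
  show "free_norm n \<rho> (\<lambda>i. - a i) = free_norm n \<rho> a"
    by (simp add: free_norm_eq)
  have s: "summable (\<lambda>d. degree_norm n a d * \<rho> ^ d)" and nn: "\<And>d. 0 \<le> degree_norm n a d * \<rho> ^ d"
    using a \<rho> radii_pos[OF \<rho>] by (auto simp: free_ball_carrier_iff)
  show "0 \<le> free_norm n \<rho> a"
    unfolding free_norm_eq using s nn by (intro suminf_nonneg) auto
  show "free_norm n \<rho> a = 0 \<longleftrightarrow> a = (\<lambda>i. 0)"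
  proof
    assume "free_norm n \<rho> a = 0"
    then have z: "degree_norm n a d = 0" for d
      using suminf_eq_zero_iff[OF s nn] radii_pos[OF \<rho>] by (auto simp: free_norm_eq)
    have "a w = 0" if "w \<in> words n" for w
    proof -
      have "w \<in> words_len n (length w)" using that by (simp add: words_len_def)
      then show ?thesis using z[of "length w"] by (simp add: L2_set_eq_0_iff finite_words_len)
    qed
    then show "a = (\<lambda>i. 0)" using a by (auto simp: free_ball_carrier_iff)
  qed (simp add: free_norm_eq L2_set_0')
next
  fix \<rho> \<rho>' a assume \<rho>: "\<rho> \<in> radii r" "\<rho>' \<in> radii r" "\<rho> \<le> \<rho>'" and a: "a \<in> free_ball_carrier n r"
  show "free_norm n \<rho> a \<le> free_norm n \<rho>' a"
    unfolding free_norm_eq using a \<rho> radii_pos[OF \<rho>(1)]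
    by (intro suminf_le mult_left_mono power_mono) (auto simp: free_ball_carrier_iff)
qed

lemma function_norms_quantum_ball:
  assumes "q \<noteq> 0" "0 < r"
  shows "function_norms (quantum_ball_carrier q n r) (radii r) (quantum_norm q n)"
proof
  show "radii r \<noteq> {}" using assms by (simp add: radii_nonempty_iff)
  show "(\<lambda>i. 0) \<in> quantum_ball_carrier q n r"
    by (simp add: quantum_ball_carrier_def)
next
  let ?t = "\<lambda>\<rho> f k. cmod (f k) * quantum_weight q n k * \<rho> ^ multi_size n k"
  fix a b assume a: "a \<in> quantum_ball_carrier q n r" and b: "b \<in> quantum_ball_carrier q n r"
  have le: "?t \<rho> (\<lambda>i. a i + b i) k \<le> ?t \<rho> a k + ?t \<rho> b k"
    if "\<rho> \<in> radii r" for \<rho> k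
    using mult_right_mono[OF norm_triangle_ineq[of "a k" "b k"], of "quantum_weight q n k * \<rho> ^ multi_size n k"]
      radii_pos[OF that] quantum_weight_nonneg[of q n k]
    by (simp add: algebra_simps)
  have sa: "(\<lambda>k. ?t \<rho> a k + ?t \<rho> b k) summable_on multi_indices n" if "\<rho> \<in> radii r" for \<rho>
    using a b that by (intro summable_on_add) (auto simp: quantum_ball_carrier_def)
  have s: "?t \<rho> (\<lambda>i. a i + b i) summable_on multi_indices n" if "\<rho> \<in> radii r" for \<rho>
    by (rule summable_on_comparison_test[OF sa[OF that]])
       (use le[OF that] radii_pos[OF that] quantum_weight_nonneg[of q n] in auto)
  show "(\<lambda>i. a i + b i) \<in> quantum_ball_carrier q n r"
    using a b s by (auto simp: quantum_ball_carrier_def)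
  show "quantum_norm q n \<rho> (\<lambda>i. a i + b i) \<le> quantum_norm q n \<rho> a + quantum_norm q n \<rho> b" if "\<rho> \<in> radii r" for \<rho>
  proof -
    have "quantum_norm q n \<rho> (\<lambda>i. a i + b i) \<le> (\<Sum>\<^sub>\<infinity>k\<in>multi_indices n. ?t \<rho> a k + ?t \<rho> b k)"
      unfolding quantum_norm_def using le s sa that by (intro infsum_mono) auto
    also have "\<dots> = quantum_norm q n \<rho> a + quantum_norm q n \<rho> b"
      unfolding quantum_norm_def using a b that by (intro infsum_add) (auto simp: quantum_ball_carrier_def)
    finally show ?thesis .
  qed
next
  fix a c assume a: "a \<in> quantum_ball_carrier q n r"
  then show "(\<lambda>i. c * a i) \<in> quantum_ball_carrier q n r"
    by (auto simp: quantum_ball_carrier_def norm_mult mult.assoc intro: summable_on_cmult_right)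
next
  let ?t = "\<lambda>\<rho> f k. cmod (f k) * quantum_weight q n k * \<rho> ^ multi_size n k"
  fix \<rho> a assume \<rho>: "\<rho> \<in> radii r" and a: "a \<in> quantum_ball_carrier q n r"
  show "quantum_norm q n \<rho> (\<lambda>i. - a i) = quantum_norm q n \<rho> a"
    by (simp add: quantum_norm_def)
  have s: "?t \<rho> a summable_on multi_indices n" and nn: "\<And>k. 0 \<le> ?t \<rho> a k"
    using a \<rho> radii_pos[OF \<rho>] quantum_weight_nonneg[of q n] by (auto simp: quantum_ball_carrier_def)
  show "0 \<le> quantum_norm q n \<rho> a"
    unfolding quantum_norm_def using nn by (intro infsum_nonneg) auto
  show "quantum_norm q n \<rho> a = 0 \<longleftrightarrow> a = (\<lambda>i. 0)"
  proof
    assume "quantum_norm q n \<rho> a = 0"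
    then have "?t \<rho> a k = 0" if "k \<in> multi_indices n" for k
      using nonneg_infsum_le_0D[OF _ s nn that] by (simp add: quantum_norm_def)
    \<comment> \<open>Definiteness rests on strictly positive weights, and this is where
      \<open>q \<noteq> 0\<close> enters.\<close>
    then have "a k = 0" if "k \<in> multi_indices n" for k
      using that radii_pos[OF \<rho>] quantum_weight_pos[OF assms(1) that] by force
    then show "a = (\<lambda>i. 0)" using a by (auto simp: quantum_ball_carrier_def)
  qed (simp add: quantum_norm_def)
next
  fix \<rho> \<rho>' a assume \<rho>: "\<rho> \<in> radii r" "\<rho>' \<in> radii r" "\<rho> \<le> \<rho>'" and a: "a \<in> quantum_ball_carrier q n r"
  show "quantum_norm q n \<rho> a \<le> quantum_norm q n \<rho>' a"
    unfolding quantum_norm_def using a \<rho> radii_pos[OF \<rho>(1)] quantum_weight_nonneg[of q n]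
    by (intro infsum_mono mult_left_mono power_mono) (auto simp: quantum_ball_carrier_def)
qed

text \<open>This lemma and the next pass between unordered sums over multi-indices, as in the circle
  and quantum norms, and series over degrees, as in \<open>free_norm\<close>. For nonnegative terms
  it suffices to bound finite partial sums, grouped by \<open>multi_size\<close>.\<close>

lemma summable_on_multi_indicesI:
  fixes F :: "(nat \<Rightarrow> nat) \<Rightarrow> real"
  assumes nn: "\<And>k. 0 \<le> F k" and s: "summable (\<lambda>d. \<Sum>k\<in>multi_indices_of_size n d. F k)"
  shows "F summable_on multi_indices n"
    and "(\<Sum>\<^sub>\<infinity>k\<in>multi_indices n. F k) \<le> (\<Sum>d. \<Sum>k\<in>multi_indices_of_size n d. F k)"
proof -
  have le: "sum F X \<le> (\<Sum>d. \<Sum>k\<in>multi_indices_of_size n d. F k)"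
    if "finite X" "X \<subseteq> multi_indices n" for X
  proof -
    have "sum F X = (\<Sum>d\<in>multi_size n ` X. \<Sum>k | k \<in> X \<and> multi_size n k = d. F k)"
      using that by (rule_tac sum.group[symmetric]) auto
    also have "\<dots> \<le> (\<Sum>d\<in>multi_size n ` X. \<Sum>k\<in>multi_indices_of_size n d. F k)"
      using that nn by (intro sum_mono sum_mono2 finite_multi_indices_of_size)
        (auto simp: multi_indices_of_size_def)
    also have "\<dots> \<le> (\<Sum>d. \<Sum>k\<in>multi_indices_of_size n d. F k)"
      using that nn by (intro sum_le_suminf[OF s]) (auto intro: sum_nonneg)
    finally show ?thesis .
  qed
  show 1: "F summable_on multi_indices n"
    by (rule nonneg_bdd_above_summable_on) (use nn le in \<open>auto intro!: bdd_aboveI2\<close>)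
  show "(\<Sum>\<^sub>\<infinity>k\<in>multi_indices n. F k) \<le> (\<Sum>d. \<Sum>k\<in>multi_indices_of_size n d. F k)"
    by (rule infsum_le_finite_sums[OF 1 le])
qed

lemma summable_multi_indices_of_size:
  fixes F :: "(nat \<Rightarrow> nat) \<Rightarrow> real"
  assumes nn: "\<And>k. 0 \<le> F k" and s: "F summable_on multi_indices n"
  shows "summable (\<lambda>d. \<Sum>k\<in>multi_indices_of_size n d. F k)"
    and "(\<Sum>d. \<Sum>k\<in>multi_indices_of_size n d. F k) \<le> (\<Sum>\<^sub>\<infinity>k\<in>multi_indices n. F k)"
proof -
  have le: "(\<Sum>d<D. \<Sum>k\<in>multi_indices_of_size n d. F k) \<le> (\<Sum>\<^sub>\<infinity>k\<in>multi_indices n. F k)" for D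
  proof -
    have "(\<Sum>d<D. \<Sum>k\<in>multi_indices_of_size n d. F k) = sum F (\<Union>d<D. multi_indices_of_size n d)"
      by (rule sum.UNION_disjoint[symmetric])
         (use finite_multi_indices_of_size in \<open>auto simp: multi_indices_of_size_def\<close>)
    also have "\<dots> \<le> (\<Sum>\<^sub>\<infinity>k\<in>multi_indices n. F k)"
      using nn finite_multi_indices_of_size
      by (intro finite_sum_le_infsum s) (auto simp: multi_indices_of_size_def)
    finally show ?thesis .
  qed
  show 1: "summable (\<lambda>d. \<Sum>k\<in>multi_indices_of_size n d. F k)"
    by (rule summableI_nonneg_bounded[OF _ le]) (auto intro: sum_nonneg nn)
  show "(\<Sum>d. \<Sum>k\<in>multi_indices_of_size n d. F k) \<le> (\<Sum>\<^sub>\<infinity>k\<in>multi_indices n. F k)"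
    by (rule suminf_le_const[OF 1 le])
qed

lemma polynomial_times_power_bounded:
  assumes "0 < \<rho>" "\<rho> < \<rho>'"
  obtains C :: real where "0 < C" "\<And>d. (real d + 1) ^ n * \<rho> ^ d \<le> C * \<rho>' ^ d"
proof -
  \<comment> \<open>The sequence \<open>(d + 1) * y ^ d\<close> is bounded because
    \<open>y < 1\<close>, and the power \<open>Suc n\<close> of its bound is the required constant.
    Taking \<open>Suc n\<close> instead of \<open>n\<close> covers \<open>n = 0\<close>; the spare
    factor \<open>d + 1\<close> is at least 1.\<close>
  define y where "y = root (Suc n) (\<rho> / \<rho>')"
  have x: "0 < \<rho> / \<rho>'" "\<rho> / \<rho>' < 1" using assms by auto
  have y: "0 < y" "y < 1" "y ^ Suc n = \<rho> / \<rho>'"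
    unfolding y_def using x by (auto simp del: power_Suc)
  have "(\<lambda>d. real d / (1 / y) ^ d) \<longlonglongrightarrow> 0"
    using y by (intro lim_n_over_pown) auto
  moreover have "(\<lambda>d. y ^ d) \<longlonglongrightarrow> 0" using y by (intro LIMSEQ_power_zero) auto
  ultimately have "(\<lambda>d. real d / (1 / y) ^ d + y ^ d) \<longlonglongrightarrow> 0 + 0"
    by (rule tendsto_add)
  then have "Bseq (\<lambda>d. real d / (1 / y) ^ d + y ^ d)"
    by (rule convergent_imp_Bseq[OF convergentI])
  then obtain K where K: "0 < K" "\<And>d. norm (real d / (1 / y) ^ d + y ^ d) \<le> K"
    by (auto simp: Bseq_def)
  have K': "(real d + 1) * y ^ d \<le> K" for d
    using K(2)[of d] by (simp add: power_divide algebra_simps)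
  have "(real d + 1) ^ n * \<rho> ^ d \<le> K ^ Suc n * \<rho>' ^ d" for d
  proof -
    have "(real d + 1) ^ n * (\<rho> / \<rho>') ^ d \<le> (real d + 1) ^ Suc n * (y ^ Suc n) ^ d"
      unfolding y(3) using x by (intro mult_right_mono power_increasing) auto
    also have "\<dots> = ((real d + 1) * y ^ d) ^ Suc n"
      unfolding power_mult_distrib by (simp only: mult.commute flip: power_mult)
    also have "\<dots> \<le> K ^ Suc n"
      using K' y by (intro power_mono) auto
    finally show ?thesis using assms by (simp add: field_simps power_divide)
  qed
  then show ?thesis using that[of "K ^ Suc n"] K(1) by simp
qed

text \<open>A block norm is at most the norm of the whole degree, and there are polynomially many
  blocks in each degree. Summability is recorded along with the bound because a divergent
  \<open>infsum\<close> has the default value 0, for which a bound alone would say nothing.\<close>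

lemma free_norm_circ_le:
  assumes "\<rho> \<in> radii r" "\<rho>' \<in> radii r" "\<rho> < \<rho>'"
  shows "\<exists>C>0. \<forall>a\<in>free_ball_carrier n r.
    (\<lambda>k. count_norm n a k * \<rho> ^ multi_size n k) summable_on multi_indices n \<and>
    free_norm_circ n \<rho> a \<le> C * free_norm n \<rho>' a"
proof -
  obtain C where C: "0 < C" "\<And>d. (real d + 1) ^ n * \<rho> ^ d \<le> C * \<rho>' ^ d"
    using polynomial_times_power_bounded[OF radii_pos[OF assms(1)] assms(3)] by metis
  have \<rho>0: "0 < \<rho>" using assms(1) by (rule radii_pos)
  have "(\<lambda>k. count_norm n a k * \<rho> ^ multi_size n k) summable_on multi_indices n \<and>
    free_norm_circ n \<rho> a \<le> C * free_norm n \<rho>' a" if a: "a \<in> free_ball_carrier n r" for a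
  proof -
    let ?F = "\<lambda>k. count_norm n a k * \<rho> ^ multi_size n k"
    let ?D = "\<lambda>d. C * (degree_norm n a d * \<rho>' ^ d)"
    have nn: "0 \<le> ?F k" for k using \<rho>0 by simp
    have le: "(\<Sum>k\<in>multi_indices_of_size n d. ?F k) \<le> ?D d" for d
    proof -
      have "?F k \<le> degree_norm n a d * \<rho> ^ d" if "k \<in> multi_indices_of_size n d" for k
      proof -
        have "words_of_counts n k \<subseteq> words_len n d"
          using that words_of_counts_subset[of n k] by (simp add: multi_indices_of_size_def)
        then have "count_norm n a k \<le> degree_norm n a d"
          unfolding L2_set_def by (intro real_sqrt_le_mono sum_mono2 finite_words_len) auto
        then show ?thesis using that \<rho>0 by (simp add: multi_indices_of_size_def mult_right_mono)
      qed
      then have "(\<Sum>k\<in>multi_indices_of_size n d. ?F k) \<le>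
          real (card (multi_indices_of_size n d)) * (degree_norm n a d * \<rho> ^ d)"
        by (rule sum_bounded_above)
      also have "\<dots> \<le> (real d + 1) ^ n * (degree_norm n a d * \<rho> ^ d)"
        using card_multi_indices_of_size(2)[of n d] \<rho>0
        by (intro mult_right_mono) (auto simp flip: of_nat_Suc of_nat_power simp: add.commute)
      also have "\<dots> = degree_norm n a d * ((real d + 1) ^ n * \<rho> ^ d)"
        by simp
      also have "\<dots> \<le> degree_norm n a d * (C * \<rho>' ^ d)"
        using C(2) by (intro mult_left_mono) auto
      finally show ?thesis by (simp add: mult_ac)
    qed
    have sD: "summable (\<lambda>d. degree_norm n a d * \<rho>' ^ d)"
      using a assms(2) by (simp add: free_ball_carrier_iff)
    have s: "summable (\<lambda>d. \<Sum>k\<in>multi_indices_of_size n d. ?F k)"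
      by (rule summable_comparison_test'[OF summable_mult[OF sD, of C], of 0])
         (use le nn in \<open>simp add: sum_nonneg\<close>)
    have "free_norm_circ n \<rho> a \<le> (\<Sum>d. \<Sum>k\<in>multi_indices_of_size n d. ?F k)"
      unfolding free_norm_circ_eq by (rule summable_on_multi_indicesI(2)[OF nn s])
    also have "\<dots> \<le> (\<Sum>d. ?D d)"
      by (intro suminf_le le s summable_mult sD)
    also have "\<dots> = C * free_norm n \<rho>' a"
      unfolding free_norm_eq by (rule suminf_mult[OF sD])
    finally show ?thesis using summable_on_multi_indicesI(1)[OF nn s] by simp
  qed
  with C(1) show ?thesis by blast
qed

text \<open>The blocks partition the words of length \<open>d\<close>, so the degree norm is the
  Euclidean norm of the vector of block norms, hence at most its l1 norm.\<close>

lemma degree_norm_le: "degree_norm n a d \<le> (\<Sum>k\<in>multi_indices_of_size n d. count_norm n a k)"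
proof -
  have "degree_norm n a d = L2_set (count_norm n a) (multi_indices_of_size n d)"
    by (simp add: L2_set_def sum_words_len sum_nonneg)
  then show ?thesis by (simp add: L2_set_le_sum)
qed

text \<open>Each coefficient is a finite sum, so the map is defined on all coefficient families, and
  its linearity and multiplicativity are purely algebraic.\<close>

definition quantum_proj :: "complex \<Rightarrow> nat \<Rightarrow> (nat list \<Rightarrow> complex) \<Rightarrow> (nat \<Rightarrow> nat) \<Rightarrow> complex" where
  "quantum_proj q n a = (\<lambda>k. \<Sum>w\<in>words_of_counts n k. a w * inverse q ^ inversions n w)"

text \<open>The section attaining equality in the Cauchy--Schwarz estimate for \<^const>\<open>quantum_proj\<close>.\<close>

definition quantum_lift :: "complex \<Rightarrow> nat \<Rightarrow> ((nat \<Rightarrow> nat) \<Rightarrow> complex) \<Rightarrow> nat list \<Rightarrow> complex" where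
  "quantum_lift q n f = (\<lambda>w. if w \<in> words n then
     f (letter_counts w) * of_real ((quantum_weight q n (letter_counts w))\<^sup>2) *
       cnj (inverse q ^ inversions n w) else 0)"

lemma quantum_weight_L2_inversions:
  assumes "q \<noteq> 0" "k \<in> multi_indices n"
  shows "quantum_weight q n k * L2_set (\<lambda>w. cmod (inverse q ^ inversions n w)) (words_of_counts n k) = 1"
proof -
  have "(quantum_weight q n k * L2_set (\<lambda>w. cmod (inverse q ^ inversions n w)) (words_of_counts n k))\<^sup>2 = 1"
    unfolding power_mult_distrib L2_set_def
    using quantum_weight_inversions[OF assms] by (simp add: sum_nonneg)
  moreover have "0 \<le> quantum_weight q n k * L2_set (\<lambda>w. cmod (inverse q ^ inversions n w)) (words_of_counts n k)"
    by (simp add: quantum_weight_nonneg)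
  ultimately show ?thesis by (simp only: power2_eq_1_iff) linarith
qed

lemma quantum_proj_le:
  assumes "q \<noteq> 0" "k \<in> multi_indices n"
  shows "cmod (quantum_proj q n a k) * quantum_weight q n k \<le> count_norm n a k"
proof -
  let ?L = "L2_set (\<lambda>w. cmod (inverse q ^ inversions n w)) (words_of_counts n k)"
  have "cmod (quantum_proj q n a k) \<le>
      (\<Sum>w\<in>words_of_counts n k. \<bar>cmod (a w)\<bar> * \<bar>cmod (inverse q ^ inversions n w)\<bar>)"
    unfolding quantum_proj_def by (rule order_trans[OF norm_sum]) (simp add: norm_mult)
  also have "\<dots> \<le> count_norm n a k * ?L"
    by (rule L2_set_mult_ineq)
  finally have "cmod (quantum_proj q n a k) * quantum_weight q n k \<le>
      count_norm n a k * ?L * quantum_weight q n k"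
    by (rule mult_right_mono) (rule quantum_weight_nonneg)
  also have "\<dots> = count_norm n a k * (quantum_weight q n k * ?L)"
    by (simp only: mult_ac)
  finally show ?thesis
    unfolding quantum_weight_L2_inversions[OF assms] by simp
qed

lemma quantum_lift_words_of_counts:
  "w \<in> words_of_counts n k \<Longrightarrow> quantum_lift q n f w =
     f k * of_real ((quantum_weight q n k)\<^sup>2) * cnj (inverse q ^ inversions n w)"
  by (auto simp: quantum_lift_def words_of_counts_def)

text \<open>Of the two weight factors in the lift, one cancels the length of the vector of powers of
  \<open>inverse q\<close>; the other is the weight in the quantum norm.\<close>

lemma count_norm_quantum_lift:
  assumes "q \<noteq> 0" "k \<in> multi_indices n"
  shows "count_norm n (quantum_lift q n f) k = cmod (f k) * quantum_weight q n k"
proof -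
  have "count_norm n (quantum_lift q n f) k =
      L2_set (\<lambda>w. cmod (f k * of_real ((quantum_weight q n k)\<^sup>2)) * cmod (inverse q ^ inversions n w))
        (words_of_counts n k)"
    by (intro L2_set_cong refl) (simp add: quantum_lift_words_of_counts norm_mult norm_power norm_inverse)
  also have "\<dots> = cmod (f k * of_real ((quantum_weight q n k)\<^sup>2)) *
      L2_set (\<lambda>w. cmod (inverse q ^ inversions n w)) (words_of_counts n k)"
    by (rule L2_set_right_distrib[symmetric]) simp
  also have "\<dots> = cmod (f k) * quantum_weight q n k *
     (quantum_weight q n k * L2_set (\<lambda>w. cmod (inverse q ^ inversions n w)) (words_of_counts n k))"
    by (simp only: norm_mult norm_of_real abs_power2) (simp add: power2_eq_square)
  finally show ?thesis
    using quantum_weight_L2_inversions[OF assms] by simp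
qed

lemma quantum_proj_outside: "k \<notin> multi_indices n \<Longrightarrow> quantum_proj q n a k = 0"
  by (simp add: quantum_proj_def words_of_counts_empty)

text \<open>The conjugate in the lift turns the pairing with the powers of \<open>inverse q\<close>
  into a sum of squared moduli, which the squared weight normalises to 1.\<close>

lemma quantum_proj_lift:
  assumes "q \<noteq> 0" "\<And>k. k \<notin> multi_indices n \<Longrightarrow> f k = 0"
  shows "quantum_proj q n (quantum_lift q n f) = f"
proof
  fix k
  show "quantum_proj q n (quantum_lift q n f) k = f k"
  proof (cases "k \<in> multi_indices n")
    case True
    have "quantum_proj q n (quantum_lift q n f) k =
        (\<Sum>w\<in>words_of_counts n k. f k *
          of_real ((quantum_weight q n k)\<^sup>2 * (cmod (inverse q ^ inversions n w))\<^sup>2))"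
      unfolding quantum_proj_def
      by (intro sum.cong refl)
         (simp only: quantum_lift_words_of_counts complex_norm_square of_real_mult mult_ac)
    also have "\<dots> = f k * of_real ((quantum_weight q n k)\<^sup>2 *
        (\<Sum>w\<in>words_of_counts n k. (cmod (inverse q ^ inversions n w))\<^sup>2))"
      by (simp only: of_real_mult of_real_sum sum_distrib_left)
    finally show ?thesis
      using quantum_weight_inversions[OF assms(1) True] by simp
  qed (simp add: quantum_proj_outside assms(2))
qed

lemma quantum_proj_norm:
  assumes "q \<noteq> 0" "a \<in> free_ball_carrier n r" "\<rho> \<in> radii r"
  shows "(\<lambda>k. cmod (quantum_proj q n a k) * quantum_weight q n k * \<rho> ^ multi_size n k)
      summable_on multi_indices n"
    and "quantum_norm q n \<rho> (quantum_proj q n a) \<le> free_norm_circ n \<rho> a"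
proof -
  obtain \<rho>' where "\<rho>' \<in> radii r" "\<rho> < \<rho>'" using radii_larger[OF assms(3)] .
  then have s: "(\<lambda>k. count_norm n a k * \<rho> ^ multi_size n k) summable_on multi_indices n"
    using free_norm_circ_le[OF assms(3)] assms(2) by blast
  have le: "cmod (quantum_proj q n a k) * quantum_weight q n k * \<rho> ^ multi_size n k
      \<le> count_norm n a k * \<rho> ^ multi_size n k" if "k \<in> multi_indices n" for k
    using quantum_proj_le[OF assms(1) that] radii_pos[OF assms(3)] by (intro mult_right_mono) auto
  show 1: "(\<lambda>k. cmod (quantum_proj q n a k) * quantum_weight q n k * \<rho> ^ multi_size n k)
      summable_on multi_indices n"
    by (rule summable_on_comparison_test[OF s])
       (use le radii_pos[OF assms(3)] quantum_weight_nonneg[of q n] in auto)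
  show "quantum_norm q n \<rho> (quantum_proj q n a) \<le> free_norm_circ n \<rho> a"
    unfolding quantum_norm_def free_norm_circ_eq by (rule infsum_mono[OF 1 s le])
qed

lemma quantum_proj_mem:
  assumes "q \<noteq> 0" "a \<in> free_ball_carrier n r"
  shows "quantum_proj q n a \<in> quantum_ball_carrier q n r"
  using quantum_proj_norm(1)[OF assms] by (simp add: quantum_ball_carrier_def quantum_proj_outside)

lemma quantum_lift_circ:
  assumes "q \<noteq> 0"
  shows "free_norm_circ n \<rho> (quantum_lift q n f) = quantum_norm q n \<rho> f"
  unfolding quantum_norm_def free_norm_circ_eq
  by (intro infsum_cong) (simp add: count_norm_quantum_lift[OF assms])

text \<open>No radius is lost in this direction: \<open>degree_norm_le\<close> bounds each degree by
  a sum of block norms of the lift, and these are the terms of the quantum norm.\<close>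

lemma quantum_lift_norm:
  assumes "q \<noteq> 0" "f \<in> quantum_ball_carrier q n r" "\<rho> \<in> radii r"
  shows "summable (\<lambda>d. degree_norm n (quantum_lift q n f) d * \<rho> ^ d)"
    and "free_norm n \<rho> (quantum_lift q n f) \<le> quantum_norm q n \<rho> f"
proof -
  let ?F = "\<lambda>k. cmod (f k) * quantum_weight q n k * \<rho> ^ multi_size n k"
  have \<rho>: "0 < \<rho>" using assms(3) by (rule radii_pos)
  have nn: "0 \<le> ?F k" for k using quantum_weight_nonneg[of q n k] \<rho> by simp
  have sF: "?F summable_on multi_indices n" using assms by (simp add: quantum_ball_carrier_def)
  note s = summable_multi_indices_of_size[OF nn sF]
  have le: "degree_norm n (quantum_lift q n f) d * \<rho> ^ d \<le> (\<Sum>k\<in>multi_indices_of_size n d. ?F k)" for d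
  proof -
    have "degree_norm n (quantum_lift q n f) d * \<rho> ^ d \<le>
        (\<Sum>k\<in>multi_indices_of_size n d. count_norm n (quantum_lift q n f) k) * \<rho> ^ d"
      using \<rho> by (intro mult_right_mono degree_norm_le) auto
    also have "\<dots> = (\<Sum>k\<in>multi_indices_of_size n d. ?F k)"
      unfolding sum_distrib_right
      by (intro sum.cong) (auto simp: multi_indices_of_size_def count_norm_quantum_lift[OF assms(1)])
    finally show ?thesis .
  qed
  show 1: "summable (\<lambda>d. degree_norm n (quantum_lift q n f) d * \<rho> ^ d)"
    using le \<rho> by (intro summable_comparison_test'[OF s(1), of 0]) auto
  have "free_norm n \<rho> (quantum_lift q n f) \<le> (\<Sum>d. \<Sum>k\<in>multi_indices_of_size n d. ?F k)"
    unfolding free_norm_eq by (intro suminf_le le 1 s)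
  also have "\<dots> \<le> quantum_norm q n \<rho> f" unfolding quantum_norm_def by (rule s(2))
  finally show "free_norm n \<rho> (quantum_lift q n f) \<le> quantum_norm q n \<rho> f" .
qed

lemma quantum_lift_mem:
  assumes "q \<noteq> 0" "f \<in> quantum_ball_carrier q n r"
  shows "quantum_lift q n f \<in> free_ball_carrier n r"
  using quantum_lift_norm(1)[OF assms] by (simp add: free_ball_carrier_iff) (simp add: quantum_lift_def)

section \<open>The algebra structure\<close>

lemma free_ball_simps:
  "carrier (free_ball n r) = free_ball_carrier n r"
  "a \<oplus>\<^bsub>free_ball n r\<^esub> b = (\<lambda>w. a w + b w)"
  "\<zero>\<^bsub>free_ball n r\<^esub> = (\<lambda>w. 0)"
  "c \<odot>\<^bsub>free_ball n r\<^esub> a = (\<lambda>w. c * a w)"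
  by (simp_all add: free_ball_def)

lemma quantum_ball_simps:
  "carrier (quantum_ball q n r) = quantum_ball_carrier q n r"
  "f \<oplus>\<^bsub>quantum_ball q n r\<^esub> g = (\<lambda>k. f k + g k)"
  "\<zero>\<^bsub>quantum_ball q n r\<^esub> = (\<lambda>k. 0)"
  "c \<odot>\<^bsub>quantum_ball q n r\<^esub> f = (\<lambda>k. c * f k)"
  by (simp_all add: quantum_ball_def)

section \<open>The concatenation product\<close>

lemma free_mult_eq:
  "(a \<otimes>\<^bsub>free_ball n r\<^esub> b) w = (\<Sum>i\<le>length w. a (take i w) * b (drop i w))"
  by (simp add: free_ball_def)

lemma L2_set_sum_le: "L2_set (\<lambda>w. \<Sum>i\<in>I. f i w) S \<le> (\<Sum>i\<in>I. L2_set (f i) S)"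
proof (induction I rule: infinite_finite_induct)
  case (insert i I)
  then show ?case
    using L2_set_triangle_ineq[of "f i" "\<lambda>w. \<Sum>i\<in>I. f i w" S] by simp
qed (simp_all add: L2_set_0')

text \<open>For a fixed cut position, cutting is a bijection from words onto pairs of words, so the
  corresponding part of the product is a tensor product and its Euclidean norm is exactly the
  product of the two norms. The triangle inequality then sums over the cut positions.\<close>

lemma degree_norm_mult:
  "degree_norm n (a \<otimes>\<^bsub>free_ball n r\<^esub> b) d \<le> (\<Sum>i\<le>d. degree_norm n a i * degree_norm n b (d - i))"
proof -
  have "degree_norm n (a \<otimes>\<^bsub>free_ball n r\<^esub> b) d \<le>
      L2_set (\<lambda>w. \<Sum>i\<le>d. cmod (a (take i w) * b (drop i w))) (words_len n d)"
    by (rule L2_set_mono) (auto simp: free_mult_eq words_len_def norm_sum)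
  also have "\<dots> \<le> (\<Sum>i\<le>d. L2_set (\<lambda>w. cmod (a (take i w) * b (drop i w))) (words_len n d))"
    by (rule L2_set_sum_le)
  also have "\<dots> = (\<Sum>i\<le>d. degree_norm n a i * degree_norm n b (d - i))"
  proof (rule sum.cong[OF refl])
    fix i assume i: "i \<in> {..d}"
    have "(\<Sum>w\<in>words_len n d. (cmod (a (take i w) * b (drop i w)))\<^sup>2) =
        (\<Sum>(u, v)\<in>words_len n i \<times> words_len n (d - i). (cmod (a u))\<^sup>2 * (cmod (b v))\<^sup>2)"
      by (rule sum.reindex_bij_witness[where i = "\<lambda>(u, v). u @ v" and j = "\<lambda>w. (take i w, drop i w)"])
         (use i in \<open>auto simp: words_len_def words_append norm_mult power_mult_distrib
            dest: in_set_takeD in_set_dropD simp: words_def\<close>)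
    then show "L2_set (\<lambda>w. cmod (a (take i w) * b (drop i w))) (words_len n d) =
        degree_norm n a i * degree_norm n b (d - i)"
      by (simp add: L2_set_def sum_product sum.cartesian_product flip: real_sqrt_mult)
  qed
  finally show ?thesis .
qed

text \<open>By \<open>degree_norm_mult\<close> the degree norms of the product are dominated by the
  Cauchy product of two convergent nonnegative series.\<close>

lemma free_mult_mem:
  assumes "a \<in> free_ball_carrier n r" "b \<in> free_ball_carrier n r"
  shows "a \<otimes>\<^bsub>free_ball n r\<^esub> b \<in> free_ball_carrier n r"
  unfolding free_ball_carrier_iff
proof (intro conjI allI impI ballI)
  fix w assume "w \<notin> words n"
  then have "take i w \<notin> words n \<or> drop i w \<notin> words n" for i
    using words_append[of "take i w" "drop i w" n] by simp
  then have "a (take i w) * b (drop i w) = 0" for i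
    using assms by (auto simp: free_ball_carrier_iff)
  then show "(a \<otimes>\<^bsub>free_ball n r\<^esub> b) w = 0"
    unfolding free_mult_eq by (intro sum.neutral) auto
next
  fix \<rho> assume \<rho>: "\<rho> \<in> radii r"
  have \<rho>0: "0 < \<rho>" by (rule radii_pos[OF \<rho>])
  have "summable (\<lambda>d. \<Sum>i\<le>d. (degree_norm n a i * \<rho> ^ i) * (degree_norm n b (d - i) * \<rho> ^ (d - i)))"
    using assms \<rho> \<rho>0 by (intro summable_Cauchy_product) (auto simp: free_ball_carrier_iff)
  moreover have "(\<Sum>i\<le>d. (degree_norm n a i * \<rho> ^ i) * (degree_norm n b (d - i) * \<rho> ^ (d - i))) =
      (\<Sum>i\<le>d. degree_norm n a i * degree_norm n b (d - i)) * \<rho> ^ d" for d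
    unfolding sum_distrib_right
    by (intro sum.cong refl) (simp add: mult_ac flip: power_add)
  ultimately have "summable (\<lambda>d. (\<Sum>i\<le>d. degree_norm n a i * degree_norm n b (d - i)) * \<rho> ^ d)"
    by simp
  then show "summable (\<lambda>d. degree_norm n (a \<otimes>\<^bsub>free_ball n r\<^esub> b) d * \<rho> ^ d)"
    by (rule summable_comparison_test'[where N = 0])
       (use \<rho>0 degree_norm_mult[where n = n and r = r and a = a and b = b] in \<open>auto intro!: mult_right_mono\<close>)
qed

lemma free_mult_assoc:
  "(a \<otimes>\<^bsub>free_ball n r\<^esub> b) \<otimes>\<^bsub>free_ball n r\<^esub> c = a \<otimes>\<^bsub>free_ball n r\<^esub> (b \<otimes>\<^bsub>free_ball n r\<^esub> c)"
proof
  fix w :: "nat list"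
  let ?m = "length w"
  have "((a \<otimes>\<^bsub>free_ball n r\<^esub> b) \<otimes>\<^bsub>free_ball n r\<^esub> c) w =
      (\<Sum>i\<le>?m. \<Sum>j\<le>i. a (take j w) * b (drop j (take i w)) * c (drop i w))"
    unfolding free_mult_eq sum_distrib_right by (intro sum.cong) (auto simp: min_def)
  also have "\<dots> = (\<Sum>(i, j)\<in>(SIGMA i:{..?m}. {..i}). a (take j w) * b (drop j (take i w)) * c (drop i w))"
    by (rule sum.Sigma) auto
  \<comment> \<open>Two cut positions \<open>j \<le> i\<close> are recoded as the first cut and the
    length of the middle piece.\<close>
  also have "\<dots> = (\<Sum>(i, j)\<in>(SIGMA i:{..?m}. {..?m - i}). a (take i w) * (b (take j (drop i w)) * c (drop j (drop i w))))"
    by (rule sum.reindex_bij_witness[where i = "\<lambda>(i, j). (i + j, i)" and j = "\<lambda>(i, j). (j, i - j)"])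
       (auto simp: drop_take add.commute)
  also have "\<dots> = (a \<otimes>\<^bsub>free_ball n r\<^esub> (b \<otimes>\<^bsub>free_ball n r\<^esub> c)) w"
    by (simp add: free_mult_eq sum_distrib_left flip: sum.Sigma)
  finally show "((a \<otimes>\<^bsub>free_ball n r\<^esub> b) \<otimes>\<^bsub>free_ball n r\<^esub> c) w =
      (a \<otimes>\<^bsub>free_ball n r\<^esub> (b \<otimes>\<^bsub>free_ball n r\<^esub> c)) w" .
qed

definition word_monom :: "nat list \<Rightarrow> nat list \<Rightarrow> complex" where
  "word_monom u = (\<lambda>w. if w = u then 1 else 0)"

lemma free_one: "\<one>\<^bsub>free_ball n r\<^esub> = word_monom []"
  by (simp add: free_ball_def word_monom_def)

lemma free_gen_eq: "free_gen i = word_monom [i]"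
  by (simp add: free_gen_def word_monom_def)

lemma free_one_mult:
  "\<one>\<^bsub>free_ball n r\<^esub> \<otimes>\<^bsub>free_ball n r\<^esub> a = a" "a \<otimes>\<^bsub>free_ball n r\<^esub> \<one>\<^bsub>free_ball n r\<^esub> = a"
proof -
  have "(\<one>\<^bsub>free_ball n r\<^esub> \<otimes>\<^bsub>free_ball n r\<^esub> a) w = (\<Sum>i\<le>length w. if i = 0 then a w else 0)" for w
    unfolding free_mult_eq free_one word_monom_def by (intro sum.cong) auto
  then show "\<one>\<^bsub>free_ball n r\<^esub> \<otimes>\<^bsub>free_ball n r\<^esub> a = a" by (simp add: fun_eq_iff)
  have "(a \<otimes>\<^bsub>free_ball n r\<^esub> \<one>\<^bsub>free_ball n r\<^esub>) w = (\<Sum>i\<le>length w. if i = length w then a w else 0)" for w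
    unfolding free_mult_eq free_one word_monom_def by (intro sum.cong) auto
  then show "a \<otimes>\<^bsub>free_ball n r\<^esub> \<one>\<^bsub>free_ball n r\<^esub> = a" by (simp add: fun_eq_iff)
qed

lemma word_monom_mult: "word_monom u \<otimes>\<^bsub>free_ball n r\<^esub> word_monom v = word_monom (u @ v)"
proof
  fix w
  have "(word_monom u \<otimes>\<^bsub>free_ball n r\<^esub> word_monom v) w =
      (\<Sum>i\<le>length w. if i = length u then if w = u @ v then 1 else 0 else 0)"
    unfolding free_mult_eq
  proof (intro sum.cong refl)
    fix i assume i: "i \<in> {..length w}"
    have "w = u @ v \<longleftrightarrow> take (length u) w = u \<and> drop (length u) w = v"
      by (metis append_eq_conv_conj)
    moreover have "take i w \<noteq> u" if "i \<noteq> length u" using i that by auto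
    ultimately show "word_monom u (take i w) * word_monom v (drop i w) =
        (if i = length u then if w = u @ v then 1 else 0 else 0)"
      by (simp add: word_monom_def)
  qed
  then show "(word_monom u \<otimes>\<^bsub>free_ball n r\<^esub> word_monom v) w = word_monom (u @ v) w"
    by (auto simp: word_monom_def)
qed

lemma free_mult_add:
  "a \<otimes>\<^bsub>free_ball n r\<^esub> (\<lambda>w. b w + c w) = (\<lambda>w. (a \<otimes>\<^bsub>free_ball n r\<^esub> b) w + (a \<otimes>\<^bsub>free_ball n r\<^esub> c) w)"
  "(\<lambda>w. a w + b w) \<otimes>\<^bsub>free_ball n r\<^esub> c = (\<lambda>w. (a \<otimes>\<^bsub>free_ball n r\<^esub> c) w + (b \<otimes>\<^bsub>free_ball n r\<^esub> c) w)"
  by (simp_all add: free_mult_eq fun_eq_iff algebra_simps sum.distrib)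

lemma free_mult_scale:
  "(\<lambda>w. z * a w) \<otimes>\<^bsub>free_ball n r\<^esub> b = (\<lambda>w. z * (a \<otimes>\<^bsub>free_ball n r\<^esub> b) w)"
  by (simp add: free_mult_eq fun_eq_iff sum_distrib_left mult_ac)

lemma free_mult_diff_scale:
  "a \<otimes>\<^bsub>free_ball n r\<^esub> (\<lambda>w. b w - z * c w) =
     (\<lambda>w. (a \<otimes>\<^bsub>free_ball n r\<^esub> b) w - z * (a \<otimes>\<^bsub>free_ball n r\<^esub> c) w)"
  "(\<lambda>w. a w - z * b w) \<otimes>\<^bsub>free_ball n r\<^esub> c =
     (\<lambda>w. (a \<otimes>\<^bsub>free_ball n r\<^esub> c) w - z * (b \<otimes>\<^bsub>free_ball n r\<^esub> c) w)"
  by (simp_all add: free_mult_eq fun_eq_iff sum_distrib_left algebra_simps sum_subtractf)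

lemma bounded_degree_mem:
  assumes "\<And>w. w \<notin> words n \<Longrightarrow> a w = 0" "\<And>w. N \<le> length w \<Longrightarrow> a w = 0"
  shows "a \<in> free_ball_carrier n r"
  unfolding free_ball_carrier_iff
proof (intro conjI allI impI ballI)
  fix \<rho>
  show "summable (\<lambda>d. degree_norm n a d * \<rho> ^ d)"
    by (rule summable_finite[of "{..<N}"]) (auto simp: not_less words_len_def assms(2) intro!: L2_set_0')
qed (use assms in auto)

lemma word_monom_mem: "u \<in> words n \<Longrightarrow> word_monom u \<in> free_ball_carrier n r"
  by (rule bounded_degree_mem[where N = "Suc (length u)"]) (auto simp: word_monom_def)

lemma ring_free_ball:
  assumes "0 < r"
  shows "ring (free_ball n r)"
proof -
  interpret function_norms "free_ball_carrier n r" "radii r" "free_norm n"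
    by (rule function_norms_free_ball[OF assms])
  have one_mem: "\<one>\<^bsub>free_ball n r\<^esub> \<in> free_ball_carrier n r"
    unfolding free_one by (rule word_monom_mem[OF words_Nil])
  show ?thesis
  proof (rule ringI)
    show "abelian_group (free_ball n r)"
    proof (rule abelian_groupI)
      fix x assume "x \<in> carrier (free_ball n r)"
      then show "\<exists>y\<in>carrier (free_ball n r). y \<oplus>\<^bsub>free_ball n r\<^esub> x = \<zero>\<^bsub>free_ball n r\<^esub>"
        by (intro bexI[of _ "\<lambda>w. - x w"]) (auto simp: free_ball_simps minus_mem)
    qed (auto simp: free_ball_simps add_mem zero_mem algebra_simps)
    show "monoid (free_ball n r)"
      by (rule monoidI)
         (auto simp: free_ball_simps free_mult_mem free_mult_assoc free_one_mult one_mem)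
  qed (auto simp: free_ball_simps free_mult_add)
qed

section \<open>Linearity and multiplicativity of the projection\<close>

lemma quantum_proj_add: "quantum_proj q n (\<lambda>w. a w + b w) = (\<lambda>k. quantum_proj q n a k + quantum_proj q n b k)"
  by (simp add: quantum_proj_def fun_eq_iff algebra_simps sum.distrib)

lemma quantum_proj_diff: "quantum_proj q n (\<lambda>w. a w - b w) = (\<lambda>k. quantum_proj q n a k - quantum_proj q n b k)"
  by (simp add: quantum_proj_def fun_eq_iff algebra_simps sum_subtractf)

lemma quantum_proj_scale: "quantum_proj q n (\<lambda>w. c * a w) = (\<lambda>k. c * quantum_proj q n a k)"
  by (simp add: quantum_proj_def fun_eq_iff sum_distrib_left mult_ac)

lemma quantum_lift_add: "quantum_lift q n (\<lambda>w. f w + g w) = (\<lambda>k. quantum_lift q n f k + quantum_lift q n g k)"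
  by (simp add: quantum_lift_def fun_eq_iff algebra_simps)

lemma quantum_lift_diff: "quantum_lift q n (\<lambda>w. f w - g w) = (\<lambda>k. quantum_lift q n f k - quantum_lift q n g k)"
  by (simp add: quantum_lift_def fun_eq_iff algebra_simps)

lemma quantum_lift_scale: "quantum_lift q n (\<lambda>w. c * f w) = (\<lambda>k. c * quantum_lift q n f k)"
  by (simp add: quantum_lift_def fun_eq_iff mult_ac)

lemma quantum_proj_word_monom:
  assumes "u \<in> words n"
  shows "quantum_proj q n (word_monom u) =
    (\<lambda>k. inverse q ^ inversions n u * quantum_monom (letter_counts u) k)"
proof
  fix k
  have "quantum_proj q n (word_monom u) k =
      (\<Sum>w\<in>words_of_counts n k. if w = u then inverse q ^ inversions n u else 0)"
    unfolding quantum_proj_def by (intro sum.cong) (auto simp: word_monom_def)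
  then show "quantum_proj q n (word_monom u) k =
      inverse q ^ inversions n u * quantum_monom (letter_counts u) k"
    using assms finite_words_of_counts[of n k]
    by (auto simp: quantum_monom_def words_of_counts_def)
qed

text \<open>Both sides run over words with letter counts \<open>m\<close> together with a cut
  position. The left side is organised by the word, the right side by the letter counts of the two
  pieces; the exponents agree by \<open>inversions_append\<close>.\<close>

lemma quantum_proj_mult:
  "quantum_proj q n (a \<otimes>\<^bsub>free_ball n r\<^esub> b) = quantum_proj q n a \<otimes>\<^bsub>quantum_ball q n r\<^esub> quantum_proj q n b"
proof
  fix m
  let ?c = "\<lambda>w. inverse q ^ inversions n w"
  show "quantum_proj q n (a \<otimes>\<^bsub>free_ball n r\<^esub> b) m =
    (quantum_proj q n a \<otimes>\<^bsub>quantum_ball q n r\<^esub> quantum_proj q n b) m"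
  proof (cases "m \<in> multi_indices n")
    \<comment> \<open>Such an \<open>m\<close> may have infinitely many splittings, but in each of
      them one part lies outside \<open>multi_indices n\<close>, where the factor is zero.\<close>
    case False
    then show ?thesis
      by (simp add: quantum_proj_outside quantum_mult_outside)
  next
    case True
    let ?S = "{(k, l). (\<lambda>i. k i + l i) = m}"
    have "quantum_proj q n (a \<otimes>\<^bsub>free_ball n r\<^esub> b) m =
        (\<Sum>(w, i)\<in>(SIGMA w:words_of_counts n m. {..length w}). a (take i w) * b (drop i w) * ?c w)"
      unfolding quantum_proj_def free_mult_eq sum_distrib_right
      by (rule sum.Sigma) (auto simp: finite_words_of_counts)
    also have "\<dots> = (\<Sum>(z, u, v)\<in>(SIGMA z:?S. words_of_counts n (fst z) \<times> words_of_counts n (snd z)).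
        a u * ?c u * (b v * ?c v) * inverse q ^ reorder_exp n (fst z) (snd z))"
    proof (rule sum.reindex_bij_witness[where i = "\<lambda>(z, u, v). (u @ v, length u)" and
          j = "\<lambda>(w, i). ((letter_counts (take i w), letter_counts (drop i w)), take i w, drop i w)"])
      fix x assume "x \<in> (SIGMA w:words_of_counts n m. {..length w})"
      then obtain w i where [simp]: "x = (w, i)" and w: "w \<in> words_of_counts n m" and i: "i \<le> length w"
        by auto
      have "take i w \<in> words n" "drop i w \<in> words n"
        using w words_append[of "take i w" "drop i w" n] by (auto simp: words_of_counts_def)
      moreover have "(\<lambda>j. letter_counts (take i w) j + letter_counts (drop i w) j) = m"
        using w letter_counts_append[of "take i w" "drop i w"] by (simp add: words_of_counts_def)
      ultimately show "(case x of (w, i) \<Rightarrow> ((letter_counts (take i w), letter_counts (drop i w)), take i w, drop i w))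
          \<in> (SIGMA z:?S. words_of_counts n (fst z) \<times> words_of_counts n (snd z))"
        by (simp add: words_of_counts_def)
      show "(case case x of (w, i) \<Rightarrow> ((letter_counts (take i w), letter_counts (drop i w)), take i w, drop i w)
          of (z, u, v) \<Rightarrow> (u @ v, length u)) = x"
        using i by simp
      show "(case case x of (w, i) \<Rightarrow> ((letter_counts (take i w), letter_counts (drop i w)), take i w, drop i w)
          of (z, u, v) \<Rightarrow> a u * ?c u * (b v * ?c v) * inverse q ^ reorder_exp n (fst z) (snd z)) =
          (case x of (w, i) \<Rightarrow> a (take i w) * b (drop i w) * ?c w)"
        using inversions_append[of n "take i w" "drop i w"] by (simp add: power_add)
    qed (auto simp: words_of_counts_def words_append letter_counts_append)
    also have "\<dots> = (\<Sum>z\<in>?S. \<Sum>(u, v)\<in>words_of_counts n (fst z) \<times> words_of_counts n (snd z).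
        a u * ?c u * (b v * ?c v) * inverse q ^ reorder_exp n (fst z) (snd z))"
      using finite_splittings[OF True]
      by (subst sum.Sigma) (auto simp: finite_words_of_counts case_prod_unfold)
    also have "\<dots> = (quantum_proj q n a \<otimes>\<^bsub>quantum_ball q n r\<^esub> quantum_proj q n b) m"
      unfolding quantum_mult_eq quantum_proj_def sum_product sum.cartesian_product
      by (simp add: case_prod_unfold sum_distrib_right)
    finally show ?thesis .
  qed
qed

lemma quantum_proj_hom:
  assumes "q \<noteq> 0"
  shows "quantum_proj q n \<in> alg_hom (free_ball n r) (quantum_ball q n r)"
proof -
  have "quantum_proj q n \<one>\<^bsub>free_ball n r\<^esub> = \<one>\<^bsub>quantum_ball q n r\<^esub>"
    unfolding free_one quantum_one quantum_proj_word_monom[OF words_Nil]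
    by (simp add: letter_counts_Nil)
  then show ?thesis
    unfolding alg_hom_def
    by (auto intro!: ring_hom_memI
        simp: quantum_proj_mem[OF assms] quantum_proj_mult quantum_proj_add quantum_proj_scale
          free_ball_simps quantum_ball_simps)
qed

lemma quantum_proj_gen:
  assumes "i \<in> {1..n}"
  shows "quantum_proj q n (free_gen i) = quantum_gen i"
proof -
  have "letter_counts [i] = (\<lambda>j. if j = i then 1 else 0)"
    by (auto simp: letter_counts_def)
  moreover have "[i] \<in> words n" using assms by (simp add: words_def)
  ultimately show ?thesis
    by (simp add: free_gen_eq quantum_proj_word_monom quantum_gen_def letter_counts_Nil reorder_exp_zero)
qed

section \<open>Straightening words modulo the commutation relations\<close>

text \<open>No inversion arises in front of letters that are all at least \<open>i\<close>; this is
  where insertion into a sorted list stops.\<close>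

lemma reorder_exp_letter_sorted:
  assumes "i \<in> {1..n}" "\<forall>j\<in>set s. i \<le> j"
  shows "reorder_exp n (letter i) (letter_counts s) = 0"
  using assms(2) unfolding reorder_exp_letter_left[OF assms(1)]
  by (force simp: letter_counts_def count_list_0_iff)

lemma count_mset_eq_count_list: "count (mset w) i = count_list w i"
  by (induction w) auto

lemma letter_counts_sort: "letter_counts (sort w) = letter_counts w"
  unfolding letter_counts_def by (rule ext) (metis count_mset_eq_count_list mset_sort)

lemma sort_eq_iff_letter_counts: "sort u = sort v \<longleftrightarrow> letter_counts u = letter_counts v"
proof
  assume "letter_counts u = letter_counts v"
  then have "mset u = mset v"
    by (simp add: multiset_eq_iff letter_counts_def fun_eq_iff count_mset_eq_count_list)
  then show "sort u = sort v"
    by (intro properties_for_sort) simp_all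
qed (metis letter_counts_sort)

lemma words_sort: "sort w \<in> words n \<longleftrightarrow> w \<in> words n"
  by (simp add: words_def)

section \<open>Ideals of the free ball algebra\<close>

locale free_ball_ideal =
  fixes n :: nat and r :: ereal and I :: "(nat list \<Rightarrow> complex) set"
  assumes r_pos: "0 < r" and ideal_I: "ideal I (free_ball n r)"
begin

sublocale function_norms "free_ball_carrier n r" "radii r" "free_norm n"
  by (rule function_norms_free_ball[OF r_pos])

interpretation ideal I "free_ball n r" by (rule ideal_I)

lemma I_add: "a \<in> I \<Longrightarrow> b \<in> I \<Longrightarrow> (\<lambda>w. a w + b w) \<in> I"
  using additive_subgroup.a_closed[OF ideal.axioms(1)[OF ideal_I], of a b] by (simp add: free_ball_simps)

lemma I_zero: "(\<lambda>w. 0) \<in> I"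
  using additive_subgroup.zero_closed[OF ideal.axioms(1)[OF ideal_I]] by (simp add: free_ball_simps)

lemma I_mult:
  assumes "a \<in> free_ball_carrier n r" "b \<in> I"
  shows "a \<otimes>\<^bsub>free_ball n r\<^esub> b \<in> I" "b \<otimes>\<^bsub>free_ball n r\<^esub> a \<in> I"
  using I_l_closed[OF assms(2)] I_r_closed[OF assms(2)] assms(1) by (simp_all add: free_ball_simps)

text \<open>A scalar acts as multiplication by a multiple of the unit, so a ring ideal is closed
  under scalars.\<close>

lemma I_scale:
  assumes "a \<in> I"
  shows "(\<lambda>w. c * a w) \<in> I"
  using I_mult(1)[OF scale_mem[OF word_monom_mem[OF words_Nil]] assms, of c]
  by (simp add: free_mult_scale free_one_mult flip: free_one[of n r])

lemma I_sum:
  assumes "finite S" "\<And>s. s \<in> S \<Longrightarrow> g s \<in> I"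
  shows "(\<lambda>w. \<Sum>s\<in>S. g s w) \<in> I"
  using assms by (induction S rule: finite_induct) (simp_all add: I_zero I_add)

end

text \<open>Subtraction in the record adds an abstract additive inverse; uniqueness of inverses in
  the ring identifies it with pointwise negation.\<close>

lemma q_commutator_eq:
  assumes "0 < r" "i \<in> {1..n}" "j \<in> {1..n}"
  shows "(free_gen i \<otimes>\<^bsub>free_ball n r\<^esub> free_gen j) \<ominus>\<^bsub>free_ball n r\<^esub>
       (q \<odot>\<^bsub>free_ball n r\<^esub> (free_gen j \<otimes>\<^bsub>free_ball n r\<^esub> free_gen i)) =
     (\<lambda>w. word_monom [i, j] w - q * word_monom [j, i] w)"
proof -
  interpret ring "free_ball n r" by (rule ring_free_ball[OF assms(1)])
  interpret function_norms "free_ball_carrier n r" "radii r" "free_norm n"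
    by (rule function_norms_free_ball[OF assms(1)])
  have "[j, i] \<in> words n" using assms by (simp add: words_def)
  then have m: "(\<lambda>w. q * word_monom [j, i] w) \<in> free_ball_carrier n r"
    by (intro scale_mem word_monom_mem)
  have "\<ominus>\<^bsub>free_ball n r\<^esub> (\<lambda>w. q * word_monom [j, i] w) = (\<lambda>w. - (q * word_monom [j, i] w))"
    by (rule minus_equality) (auto simp: free_ball_simps m minus_mem[OF m])
  then show ?thesis
    by (simp add: a_minus_def free_gen_eq word_monom_mult free_ball_simps)
qed

locale q_commutator_ideal = free_ball_ideal +
  fixes q :: complex
  assumes q_nonzero: "q \<noteq> 0" and commutators: "q_commutators q n r \<subseteq> I"
begin

text \<open>The relation multiplied by \<open>- inverse q\<close> becomes a rewriting rule for a
  descent: removing one inversion costs one factor \<open>inverse q\<close>.\<close>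

lemma swap_mem:
  assumes "j \<in> {1..n}" "i \<in> {1..n}" "j < i"
  shows "(\<lambda>w. word_monom [i, j] w - inverse q * word_monom [j, i] w) \<in> I"
proof -
  have "(free_gen j \<otimes>\<^bsub>free_ball n r\<^esub> free_gen i) \<ominus>\<^bsub>free_ball n r\<^esub>
       (q \<odot>\<^bsub>free_ball n r\<^esub> (free_gen i \<otimes>\<^bsub>free_ball n r\<^esub> free_gen j)) \<in> q_commutators q n r"
    using assms unfolding q_commutators_def by auto
  then have "(\<lambda>w. word_monom [j, i] w - q * word_monom [i, j] w) \<in> I"
    using commutators by (auto simp: q_commutator_eq[OF r_pos assms(1,2)])
  then have "(\<lambda>w. - inverse q * (word_monom [j, i] w - q * word_monom [i, j] w)) \<in> I"
    by (rule I_scale)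
  moreover have "- inverse q * (word_monom [j, i] w - q * word_monom [i, j] w) =
      word_monom [i, j] w - inverse q * word_monom [j, i] w" for w
    using q_nonzero by (simp add: field_simps)
  ultimately show ?thesis by simp
qed

text \<open>Inserting \<open>i\<close> into a sorted word swaps it past exactly the smaller letters,
  and each swap contributes one factor \<open>inverse q\<close>.\<close>

lemma insort_mem:
  assumes "i \<in> {1..n}" "s \<in> words n" "sorted s"
  shows "(\<lambda>w. word_monom (i # s) w -
    inverse q ^ reorder_exp n (letter i) (letter_counts s) * word_monom (insort i s) w) \<in> I"
  using assms(2,3)
proof (induction s)
  case Nil
  then show ?case by (simp add: letter_counts_Nil reorder_exp_zero I_zero)
next
  case (Cons j s)
  show ?case
  proof (cases "i \<le> j")
    case True
    then have "reorder_exp n (letter i) (letter_counts (j # s)) = 0"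
      using Cons.prems by (intro reorder_exp_letter_sorted[OF assms(1)]) auto
    then show ?thesis using True by (simp add: I_zero)
  next
    case False
    let ?e = "inverse q ^ reorder_exp n (letter i) (letter_counts s)"
    have j: "j \<in> {1..n}" and s: "s \<in> words n" "sorted s" and ji: "j < i"
      using Cons.prems False by (auto simp: words_Cons)
    have "reorder_exp n (letter i) (letter j) = 1"
      unfolding reorder_exp_letter_left[OF assms(1)] using j ji by (simp add: letter_def)
    then have e: "inverse q ^ reorder_exp n (letter i) (letter_counts (j # s)) = inverse q * ?e"
      by (simp add: letter_counts_Cons reorder_exp_add)
    have "[j] \<in> words n" using j by (simp add: words_def)
    then have "(\<lambda>w. inverse q * (word_monom (j # i # s) w - ?e * word_monom (j # insort i s) w)) \<in> I"
      using I_scale[OF I_mult(1)[OF word_monom_mem Cons.IH[OF s]], of "[j]" "inverse q"]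
      by (simp add: free_mult_diff_scale word_monom_mult)
    moreover have "(\<lambda>w. word_monom (i # j # s) w - inverse q * word_monom (j # i # s) w) \<in> I"
      using I_mult(2)[OF word_monom_mem[OF s(1)] swap_mem[OF j assms(1) ji]]
      by (simp add: free_mult_diff_scale word_monom_mult)
    \<comment> \<open>One swap at the front, then insertion into the tail: the intermediate word
      \<open>j # i # s\<close> cancels in the sum.\<close>
    ultimately have "(\<lambda>w. (word_monom (i # j # s) w - inverse q * word_monom (j # i # s) w) +
        inverse q * (word_monom (j # i # s) w - ?e * word_monom (j # insort i s) w)) \<in> I"
      by (rule I_add[rotated])
    then show ?thesis unfolding e using False by (simp add: algebra_simps)
  qed
qed

text \<open>Insertion sort follows the recursion of \<open>inversions\<close>: inserting
  \<open>i\<close> into \<open>sort u\<close> costs as much as placing \<open>i\<close> in front of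
  \<open>u\<close>, since the form depends only on letter counts.\<close>

lemma sort_mem:
  assumes "u \<in> words n"
  shows "(\<lambda>w. word_monom u w - inverse q ^ inversions n u * word_monom (sort u) w) \<in> I"
  using assms
proof (induction u)
  case Nil
  then show ?case by (simp add: I_zero)
next
  case (Cons i u)
  then have i: "i \<in> {1..n}" and u: "u \<in> words n" by (auto simp: words_Cons)
  let ?c = "inverse q ^ inversions n u"
  let ?e = "inverse q ^ reorder_exp n (letter i) (letter_counts u)"
  have "[i] \<in> words n" using i by (simp add: words_def)
  then have "(\<lambda>w. word_monom (i # u) w - ?c * word_monom (i # sort u) w) \<in> I"
    using I_mult(1)[OF word_monom_mem Cons.IH[OF u], of "[i]"]
    by (simp add: free_mult_diff_scale word_monom_mult)
  moreover have "(\<lambda>w. ?c * (word_monom (i # sort u) w - ?e * word_monom (insort i (sort u)) w)) \<in> I"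
    using I_scale[OF insort_mem[OF i, of "sort u"], of ?c] u
    by (simp add: words_sort letter_counts_sort)
  ultimately have "(\<lambda>w. (word_monom (i # u) w - ?c * word_monom (i # sort u) w) +
      ?c * (word_monom (i # sort u) w - ?e * word_monom (insort i (sort u)) w)) \<in> I"
    by (rule I_add)
  then show ?case by (simp add: algebra_simps power_add)
qed

text \<open>Subtract from each word in the degree-\<open>d\<close> part of \<open>a\<close> its
  sorted form with the coefficient from \<open>sort_mem\<close>. All words with letter counts
  \<open>k\<close> share one sorted form, and its total coefficient is
  \<open>quantum_proj q n a k\<close>, which is zero; so the subtraction changes nothing.\<close>

lemma homogeneous_mem:
  assumes "quantum_proj q n a = (\<lambda>k. 0)"
  shows "(\<lambda>w. if w \<in> words_len n d then a w else 0) \<in> I"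
proof -
  let ?c = "\<lambda>u. inverse q ^ inversions n u"
  have "(\<lambda>w. \<Sum>u\<in>words_len n d. a u * (word_monom u w - ?c u * word_monom (sort u) w)) \<in> I"
    by (intro I_sum finite_words_len I_scale sort_mem) (simp add: words_len_def)
  moreover have "(\<Sum>u\<in>words_len n d. a u * (word_monom u w - ?c u * word_monom (sort u) w)) =
      (if w \<in> words_len n d then a w else 0)" for w
  proof -
    have "(\<Sum>u\<in>words_len n d. a u * ?c u * word_monom (sort u) w) =
        (\<Sum>k\<in>multi_indices_of_size n d. \<Sum>u\<in>words_of_counts n k. a u * ?c u * word_monom (sort u) w)"
      by (rule sum_words_len)
    also have "\<dots> = 0"
    proof (rule sum.neutral, rule ballI)
      fix k
      \<comment> \<open>The right-hand side does not mention \<open>u\<close>, so it factors out of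
        the sum over the block.\<close>
      have "word_monom (sort u) w = (if w = sort w \<and> letter_counts w = k then 1 else 0)"
        if "u \<in> words_of_counts n k" for u
      proof -
        have "letter_counts u = k" using that by (simp add: words_of_counts_def)
        then have "w = sort u \<longleftrightarrow> w = sort w \<and> letter_counts w = k"
          by (metis sort_eq_iff_letter_counts letter_counts_sort)
        then show ?thesis by (simp only: word_monom_def)
      qed
      then have "(\<Sum>u\<in>words_of_counts n k. a u * ?c u * word_monom (sort u) w) =
          quantum_proj q n a k * (if w = sort w \<and> letter_counts w = k then 1 else 0)"
        unfolding quantum_proj_def sum_distrib_right by (intro sum.cong) auto
      then show "(\<Sum>u\<in>words_of_counts n k. a u * ?c u * word_monom (sort u) w) = 0"
        using assms by simp
    qed
    finally have z: "(\<Sum>u\<in>words_len n d. a u * ?c u * word_monom (sort u) w) = 0" .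
    have "(\<Sum>u\<in>words_len n d. a u * word_monom u w) = (\<Sum>u\<in>words_len n d. if u = w then a u else 0)"
      by (intro sum.cong) (auto simp: word_monom_def)
    then show ?thesis
      using z finite_words_len[of n d] by (simp add: right_diff_distrib sum_subtractf mult.assoc)
  qed
  ultimately show ?thesis by simp
qed

lemma truncation_mem:
  assumes "a \<in> free_ball_carrier n r" "quantum_proj q n a = (\<lambda>k. 0)"
  shows "(\<lambda>w. if length w < N then a w else 0) \<in> I"
proof -
  have "(\<lambda>w. \<Sum>d<N. if w \<in> words_len n d then a w else 0) \<in> I"
    by (intro I_sum homogeneous_mem assms) simp
  moreover have "(\<Sum>d<N. if w \<in> words_len n d then a w else 0) = (if length w < N then a w else 0)" for w
  proof -
    have "(\<Sum>d<N. if w \<in> words_len n d then a w else 0) = (\<Sum>d<N. if d = length w then a w else 0)"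
      using assms(1) by (intro sum.cong) (auto simp: words_len_def free_ball_carrier_iff)
    then show ?thesis by simp
  qed
  ultimately show ?thesis by simp
qed

end

text \<open>The error is minus the tail of \<open>a\<close>, so its norm is a remainder of the
  convergent series for \<open>free_norm n \<rho> a\<close>.\<close>

lemma free_norm_truncation:
  assumes "a \<in> free_ball_carrier n r" "\<rho> \<in> radii r"
  shows "(\<lambda>N. free_norm n \<rho> (\<lambda>w. (if length w < N then a w else 0) - a w)) \<longlonglongrightarrow> 0"
proof -
  let ?t = "\<lambda>d. degree_norm n a d * \<rho> ^ d"
  have s: "summable ?t" using assms by (simp add: free_ball_carrier_iff)
  have "free_norm n \<rho> (\<lambda>w. (if length w < N then a w else 0) - a w) = (\<Sum>d. ?t d) - (\<Sum>d<N. ?t d)" for N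
  proof -
    have "degree_norm n (\<lambda>w. (if length w < N then a w else 0) - a w) d * \<rho> ^ d =
        ?t d - (if d \<in> {..<N} then ?t d else 0)" for d
    proof (cases "d < N")
      case True
      then have "degree_norm n (\<lambda>w. (if length w < N then a w else 0) - a w) d = 0"
        by (intro L2_set_0') (auto simp: words_len_def)
      then show ?thesis using True by simp
    next
      case False
      then have "degree_norm n (\<lambda>w. (if length w < N then a w else 0) - a w) d = degree_norm n a d"
        by (intro L2_set_cong refl) (auto simp: words_len_def)
      then show ?thesis using False by simp
    qed
    moreover have "(\<lambda>d. ?t d - (if d \<in> {..<N} then ?t d else 0)) sums ((\<Sum>d. ?t d) - (\<Sum>d<N. ?t d))"
      by (intro sums_diff summable_sums[OF s] sums_If_finite_set) simp
    ultimately show ?thesis by (simp add: free_norm_eq sums_iff)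
  qed
  moreover have "(\<lambda>N. (\<Sum>d. ?t d) - (\<Sum>d<N. ?t d)) \<longlonglongrightarrow> (\<Sum>d. ?t d) - (\<Sum>d. ?t d)"
    by (intro tendsto_diff tendsto_const summable_LIMSEQ[OF s])
  ultimately show ?thesis by simp
qed

lemma (in q_commutator_ideal) kernel_subset_closed_ideal:
  assumes "closedin T I" "a \<in> free_ball_carrier n r" "quantum_proj q n a = (\<lambda>k. 0)"
  shows "a \<in> I"
proof (rule closedin_mem[OF assms(1,2)])
  fix \<rho> \<epsilon> :: real assume "\<rho> \<in> radii r" "0 < \<epsilon>"
  then have "\<forall>\<^sub>F N in sequentially. free_norm n \<rho> (\<lambda>w. (if length w < N then a w else 0) - a w) < \<epsilon>"
    using free_norm_truncation[OF assms(2)] by (intro order_tendstoD(2)) auto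
  then obtain N where "free_norm n \<rho> (\<lambda>w. (if length w < N then a w else 0) - a w) < \<epsilon>"
    by (auto simp: eventually_sequentially)
  then show "\<exists>b\<in>I. free_norm n \<rho> (\<lambda>i. b i - a i) < \<epsilon>"
    using truncation_mem[OF assms(2,3), of N]
    by (intro bexI[of _ "\<lambda>w. if length w < N then a w else 0"])
qed

section \<open>The kernel and its complement\<close>

text \<open>The sharp estimate is in terms of \<open>free_norm_circ\<close>, while the topology
  comes from \<open>free_norm\<close>; comparing the two moves from \<open>\<rho>\<close> to a
  larger \<open>\<rho>'\<close>.\<close>

lemma continuous_map_quantum_proj:
  assumes "q \<noteq> 0" "0 < r"
  shows "continuous_map (free_ball_topology n r) (quantum_ball_topology q n r) (quantum_proj q n)"
  unfolding free_ball_topology_def quantum_ball_topology_def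
proof (rule continuous_map_of_norm_bound)
  fix \<rho> assume \<rho>: "\<rho> \<in> radii r"
  then obtain \<rho>' where \<rho>': "\<rho>' \<in> radii r" "\<rho> < \<rho>'" by (rule radii_larger)
  obtain C where "C > 0" "\<And>a. a \<in> free_ball_carrier n r \<Longrightarrow> free_norm_circ n \<rho> a \<le> C * free_norm n \<rho>' a"
    using free_norm_circ_le[OF \<rho> \<rho>'] by blast
  then show "\<exists>\<rho>'\<in>radii r. \<exists>C>0. \<forall>a\<in>free_ball_carrier n r. quantum_norm q n \<rho> (quantum_proj q n a) \<le> C * free_norm n \<rho>' a"
    using \<rho>'(1) order_trans[OF quantum_proj_norm(2)[OF assms(1) _ \<rho>]] by blast
qed (use assms in \<open>auto simp: quantum_proj_mem quantum_proj_diff function_norms_free_ball function_norms_quantum_ball\<close>)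

text \<open>The idempotent whose kernel is that of the projection and whose range is that of the
  section.\<close>

definition kernel_complement_proj ::
    "complex \<Rightarrow> nat \<Rightarrow> (nat list \<Rightarrow> complex) \<Rightarrow> nat list \<Rightarrow> complex" where
  "kernel_complement_proj q n a = quantum_lift q n (quantum_proj q n a)"

lemma kernel_complement_proj_diff:
  "kernel_complement_proj q n (\<lambda>w. a w - b w) =
    (\<lambda>w. kernel_complement_proj q n a w - kernel_complement_proj q n b w)"
  by (simp add: kernel_complement_proj_def quantum_proj_diff quantum_lift_diff)

lemma kernel_complement_proj_mem:
  assumes "q \<noteq> 0" "a \<in> free_ball_carrier n r"
  shows "kernel_complement_proj q n a \<in> free_ball_carrier n r"
  unfolding kernel_complement_proj_def
  by (rule quantum_lift_mem[OF assms(1) quantum_proj_mem[OF assms]])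

lemma quantum_proj_kernel_complement_proj:
  assumes "q \<noteq> 0"
  shows "quantum_proj q n (kernel_complement_proj q n a) = quantum_proj q n a"
  unfolding kernel_complement_proj_def
  by (rule quantum_proj_lift[OF assms]) (rule quantum_proj_outside)

text \<open>The clause \<open>\<rho> < \<rho>'\<close> is kept so that monotonicity can bound the
  identity at the same larger radius when the complementary idempotent is treated.\<close>

lemma kernel_complement_proj_bound:
  assumes "q \<noteq> 0" "\<rho> \<in> radii r"
  shows "\<exists>\<rho>'\<in>radii r. \<exists>C>0. \<rho> < \<rho>' \<and> (\<forall>a\<in>free_ball_carrier n r.
    free_norm n \<rho> (kernel_complement_proj q n a) \<le> C * free_norm n \<rho>' a)"
proof -
  obtain \<rho>' where \<rho>': "\<rho>' \<in> radii r" "\<rho> < \<rho>'" using radii_larger[OF assms(2)] .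
  obtain C where C: "C > 0" "\<And>a. a \<in> free_ball_carrier n r \<Longrightarrow> free_norm_circ n \<rho> a \<le> C * free_norm n \<rho>' a"
    using free_norm_circ_le[OF assms(2) \<rho>'] by blast
  have "free_norm n \<rho> (kernel_complement_proj q n a) \<le> C * free_norm n \<rho>' a"
    if "a \<in> free_ball_carrier n r" for a
    unfolding kernel_complement_proj_def
    using quantum_lift_norm(2)[OF assms(1) quantum_proj_mem[OF assms(1) that] assms(2)]
      quantum_proj_norm(2)[OF assms(1) that assms(2)] C(2)[OF that] by linarith
  with \<rho>' C(1) show ?thesis by blast
qed

lemma continuous_map_kernel_complement_proj:
  assumes "q \<noteq> 0" "0 < r"
  shows "continuous_map (free_ball_topology n r) (free_ball_topology n r) (kernel_complement_proj q n)"
  unfolding free_ball_topology_def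
proof (rule continuous_map_of_norm_bound)
  show "\<exists>\<rho>'\<in>radii r. \<exists>C>0. \<forall>a\<in>free_ball_carrier n r.
      free_norm n \<rho> (kernel_complement_proj q n a) \<le> C * free_norm n \<rho>' a" if "\<rho> \<in> radii r" for \<rho>
    using kernel_complement_proj_bound[OF assms(1) that] by blast
qed (use assms in \<open>auto simp: kernel_complement_proj_mem kernel_complement_proj_diff function_norms_free_ball\<close>)

lemma continuous_map_kernel_proj:
  assumes "q \<noteq> 0" "0 < r"
  shows "continuous_map (free_ball_topology n r) (free_ball_topology n r)
    (\<lambda>a w. a w - kernel_complement_proj q n a w)"
proof -
  interpret function_norms "free_ball_carrier n r" "radii r" "free_norm n"
    by (rule function_norms_free_ball[OF assms(2)])
  show ?thesis
    unfolding free_ball_topology_def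
  proof (rule continuous_map_of_norm_bound)
    fix \<rho> assume \<rho>: "\<rho> \<in> radii r"
    obtain \<rho>' C where \<rho>': "\<rho>' \<in> radii r" "\<rho> < \<rho>'" and C: "C > 0"
      "\<And>a. a \<in> free_ball_carrier n r \<Longrightarrow> free_norm n \<rho> (kernel_complement_proj q n a) \<le> C * free_norm n \<rho>' a"
      using kernel_complement_proj_bound[OF assms(1) \<rho>] by meson
    \<comment> \<open>The summand 1 bounds the identity, by monotonicity in the radius, and
      \<open>C\<close> bounds the idempotent.\<close>
    have "free_norm n \<rho> (\<lambda>w. a w - kernel_complement_proj q n a w) \<le> (1 + C) * free_norm n \<rho>' a"
      if a: "a \<in> free_ball_carrier n r" for a
    proof -
      note E = kernel_complement_proj_mem[OF assms(1) a]
      show ?thesis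
        using norm_triangle[OF \<rho> a minus_mem[OF E]] norm_minus[OF \<rho> E] C(2)[OF a]
          norm_mono[OF \<rho> \<rho>'(1) less_imp_le[OF \<rho>'(2)] a]
        by (simp add: algebra_simps)
    qed
    with \<rho>'(1) C(1) show "\<exists>\<rho>'\<in>radii r. \<exists>C>0. \<forall>a\<in>free_ball_carrier n r.
        free_norm n \<rho> (\<lambda>w. a w - kernel_complement_proj q n a w) \<le> C * free_norm n \<rho>' a"
      by (intro bexI[of _ \<rho>'] exI[of _ "1 + C"]) auto
  qed (use assms in \<open>auto simp: kernel_complement_proj_mem kernel_complement_proj_diff
      function_norms_free_ball diff_mem\<close>)
qed

section \<open>The kernel as a closed ideal\<close>

lemma kernel_eq:
  "a_kernel (free_ball n r) (quantum_ball q n r) h =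
    {a \<in> free_ball_carrier n r. h a = (\<lambda>k. 0)}"
  by (simp add: a_kernel_def kernel_def free_ball_simps quantum_ball_simps)

lemma topspace_free_ball:
  "0 < r \<Longrightarrow> topspace (free_ball_topology n r) = free_ball_carrier n r"
  unfolding free_ball_topology_def
  by (rule function_norms.topspace_norms_topology[OF function_norms_free_ball])

lemma closedin_kernel:
  assumes "q \<noteq> 0" "0 < r"
  shows "closedin (free_ball_topology n r)
    (a_kernel (free_ball n r) (quantum_ball q n r) (quantum_proj q n))"
proof -
  have "closedin (quantum_ball_topology q n r) {\<lambda>k. 0}"
    unfolding quantum_ball_topology_def
    by (rule function_norms.closedin_zero[OF function_norms_quantum_ball[OF assms]])
  from closedin_continuous_map_preimage[OF continuous_map_quantum_proj[OF assms] this]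
  show ?thesis
    by (simp add: kernel_eq topspace_free_ball[OF assms(2)])
qed

lemma ideal_kernel:
  assumes "q \<noteq> 0" "0 < r"
  shows "ideal (a_kernel (free_ball n r) (quantum_ball q n r) (quantum_proj q n)) (free_ball n r)"
proof -
  interpret A: ring "free_ball n r" by (rule ring_free_ball[OF assms(2)])
  interpret N: function_norms "free_ball_carrier n r" "radii r" "free_norm n"
    by (rule function_norms_free_ball[OF assms(2)])
  have inv: "\<ominus>\<^bsub>free_ball n r\<^esub> a = (\<lambda>w. - a w)" if "a \<in> free_ball_carrier n r" for a
    by (rule A.minus_equality) (auto simp: free_ball_simps that N.minus_mem)
  \<comment> \<open>The ideal property follows from multiplicativity of the projection, because zero
    annihilates under the product of the target.\<close>
  have z: "(\<lambda>k. 0) \<otimes>\<^bsub>quantum_ball q n r\<^esub> f = (\<lambda>k. 0)" "f \<otimes>\<^bsub>quantum_ball q n r\<^esub> (\<lambda>k. 0) = (\<lambda>k. 0)" for f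
    by (auto simp: fun_eq_iff quantum_mult_eq)
  show ?thesis
  proof (rule idealI[OF A.ring_axioms])
    show "subgroup (a_kernel (free_ball n r) (quantum_ball q n r) (quantum_proj q n))
        (add_monoid (free_ball n r))"
    proof (rule A.add.subgroupI)
      fix a assume "a \<in> a_kernel (free_ball n r) (quantum_ball q n r) (quantum_proj q n)"
      then have a: "a \<in> free_ball_carrier n r" "quantum_proj q n a = (\<lambda>k. 0)" by (auto simp: kernel_eq)
      then show "\<ominus>\<^bsub>free_ball n r\<^esub> a \<in> a_kernel (free_ball n r) (quantum_ball q n r) (quantum_proj q n)"
        using quantum_proj_scale[of q n "-1" a] by (simp add: kernel_eq inv N.minus_mem)
    next
      have "(\<lambda>w. 0) \<in> a_kernel (free_ball n r) (quantum_ball q n r) (quantum_proj q n)"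
        by (simp add: kernel_eq N.zero_mem quantum_proj_def)
      then show "a_kernel (free_ball n r) (quantum_ball q n r) (quantum_proj q n) \<noteq> {}" by blast
    qed (auto simp: kernel_eq free_ball_simps N.add_mem quantum_proj_add)
  qed (auto simp: kernel_eq free_ball_simps free_mult_mem quantum_proj_mult z)
qed

lemma q_commutators_kernel:
  assumes "q \<noteq> 0" "0 < r"
  shows "q_commutators q n r \<subseteq> a_kernel (free_ball n r) (quantum_ball q n r) (quantum_proj q n)"
proof
  interpret N: function_norms "free_ball_carrier n r" "radii r" "free_norm n"
    by (rule function_norms_free_ball[OF assms(2)])
  fix x assume "x \<in> q_commutators q n r"
  then obtain i j where x: "x = (free_gen i \<otimes>\<^bsub>free_ball n r\<^esub> free_gen j) \<ominus>\<^bsub>free_ball n r\<^esub>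
       (q \<odot>\<^bsub>free_ball n r\<^esub> (free_gen j \<otimes>\<^bsub>free_ball n r\<^esub> free_gen i))"
    and ij: "1 \<le> i" "i < j" "j \<le> n" unfolding q_commutators_def by blast
  then have i: "i \<in> {1..n}" and j: "j \<in> {1..n}" by auto
  have x': "x = (\<lambda>w. (free_gen i \<otimes>\<^bsub>free_ball n r\<^esub> free_gen j) w - q * (free_gen j \<otimes>\<^bsub>free_ball n r\<^esub> free_gen i) w)"
    unfolding x q_commutator_eq[OF assms(2) i j] by (simp add: free_gen_eq word_monom_mult)
  have "quantum_proj q n x = (\<lambda>k. 0)"
    unfolding x' quantum_proj_diff quantum_proj_scale quantum_proj_mult
      quantum_proj_gen[OF i] quantum_proj_gen[OF j] quantum_gen_relation[OF assms(1) ij]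
    by (simp add: quantum_ball_simps)
  moreover have "x \<in> free_ball_carrier n r"
    unfolding x' using i j
    by (intro N.diff_mem N.scale_mem free_mult_mem)
       (auto simp: free_gen_eq words_def intro!: word_monom_mem)
  ultimately show "x \<in> a_kernel (free_ball n r) (quantum_ball q n r) (quantum_proj q n)"
    by (simp add: kernel_eq)
qed

lemma kernel_eq_closed_ideal_generated:
  assumes "q \<noteq> 0" "0 < r"
  shows "a_kernel (free_ball n r) (quantum_ball q n r) (quantum_proj q n) =
    closed_ideal_generated (free_ball n r) (free_ball_topology n r) (q_commutators q n r)"
proof
  show "closed_ideal_generated (free_ball n r) (free_ball_topology n r) (q_commutators q n r)
      \<subseteq> a_kernel (free_ball n r) (quantum_ball q n r) (quantum_proj q n)"
    unfolding closed_ideal_generated_def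
    using ideal_kernel[OF assms] closedin_kernel[OF assms] q_commutators_kernel[OF assms] by blast
  show "a_kernel (free_ball n r) (quantum_ball q n r) (quantum_proj q n)
      \<subseteq> closed_ideal_generated (free_ball n r) (free_ball_topology n r) (q_commutators q n r)"
    unfolding closed_ideal_generated_def
  proof clarify
    fix a I assume a: "a \<in> a_kernel (free_ball n r) (quantum_ball q n r) (quantum_proj q n)"
      and I: "ideal I (free_ball n r)" "closedin (free_ball_topology n r) I" "q_commutators q n r \<subseteq> I"
    \<comment> \<open>The straightening argument applies to an arbitrary closed ideal containing the
      commutators, hence to the intersection of all of them.\<close>
    interpret q_commutator_ideal n r I q
      using I assms
      by (intro q_commutator_ideal.intro free_ball_ideal.intro q_commutator_ideal_axioms.intro)
    show "a \<in> I"
      using kernel_subset_closed_ideal[of a] I(2) a by (simp add: free_ball_topology_def kernel_eq)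
  qed
qed

lemma complemented_kernel:
  assumes "q \<noteq> 0" "0 < r"
  shows "complemented_subspace (free_ball n r) (free_ball_topology n r)
    (a_kernel (free_ball n r) (quantum_ball q n r) (quantum_proj q n))"
proof -
  interpret N: function_norms "free_ball_carrier n r" "radii r" "free_norm n"
    by (rule function_norms_free_ball[OF assms(2)])
  let ?T = "free_ball_topology n r" and ?A = "free_ball_carrier n r"
  let ?E = "kernel_complement_proj q n"
  let ?K = "a_kernel (free_ball n r) (quantum_ball q n r) (quantum_proj q n)"
  \<comment> \<open>The range of the idempotent \<open>?E\<close>, written as its set of fixed
    points so that it is the zero set of the continuous map \<open>a - ?E a\<close> and therefore
    closed.\<close>
  define M where "M = {a \<in> ?A. ?E a = a}"
  have T: "topspace ?T = ?A" by (rule topspace_free_ball[OF assms(2)])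
  have Em: "?E a \<in> ?A" if "a \<in> ?A" for a using kernel_complement_proj_mem[OF assms(1) that] .
  have EE: "?E (?E a) = ?E a" for a
    using quantum_proj_kernel_complement_proj[OF assms(1)] by (simp add: kernel_complement_proj_def)
  have E_add: "?E (\<lambda>w. a w + b w) = (\<lambda>w. ?E a w + ?E b w)" for a b
    by (simp add: kernel_complement_proj_def quantum_proj_add quantum_lift_add)
  have EK: "?E a = (\<lambda>w. 0)" if "a \<in> ?K" for a
  proof -
    have "quantum_proj q n a = (\<lambda>k. 0)" using that by (simp add: kernel_eq)
    then show ?thesis by (intro ext) (simp add: kernel_complement_proj_def quantum_lift_def)
  qed
  have E_scale: "?E (\<lambda>w. c * a w) = (\<lambda>w. c * ?E a w)" for c a
    by (simp add: kernel_complement_proj_def quantum_proj_scale quantum_lift_scale)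
  have E_zero: "?E (\<lambda>w. 0) = (\<lambda>w. 0)"
    using E_scale[of 0] by simp
  have "lin_subspace (free_ball n r) ?K"
    by (auto simp: lin_subspace_def kernel_eq free_ball_simps N.zero_mem N.add_mem N.scale_mem
        quantum_proj_add quantum_proj_scale) (simp add: quantum_proj_def)
  moreover have "lin_subspace (free_ball n r) M"
    by (auto simp: lin_subspace_def M_def free_ball_simps N.zero_mem N.add_mem N.scale_mem
        E_add E_scale E_zero)
  moreover have "closedin ?T M"
  proof -
    have "closedin ?T {\<lambda>w. 0}"
      unfolding free_ball_topology_def by (rule N.closedin_zero)
    note closedin_continuous_map_preimage[OF continuous_map_kernel_proj[OF assms] this]
    moreover have "(\<lambda>w. a w - ?E a w) \<in> {\<lambda>w. 0} \<longleftrightarrow> ?E a = a" for a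
      by (auto simp: fun_eq_iff)
    ultimately show ?thesis by (simp only: T M_def)
  qed
  \<comment> \<open>The inverse of addition is explicit: \<open>a - ?E a\<close> is the kernel
    component and \<open>?E a\<close> the component in \<open>M\<close>.\<close>
  moreover have "homeomorphic_maps (prod_topology (subtopology ?T ?K) (subtopology ?T M)) ?T
      (\<lambda>(a, b). a \<oplus>\<^bsub>free_ball n r\<^esub> b) (\<lambda>a. (\<lambda>w. a w - ?E a w, ?E a))"
    unfolding homeomorphic_maps_def
  proof (intro conjI ballI)
    have "continuous_map (prod_topology ?T ?T) ?T (\<lambda>(a, b). a \<oplus>\<^bsub>free_ball n r\<^esub> b)"
      unfolding free_ball_simps free_ball_topology_def by (rule N.continuous_map_add)
    then show "continuous_map (prod_topology (subtopology ?T ?K) (subtopology ?T M)) ?T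
        (\<lambda>(a, b). a \<oplus>\<^bsub>free_ball n r\<^esub> b)"
      unfolding subtopology_Times[symmetric] by (rule continuous_map_from_subtopology)
    have "(\<lambda>w. a w - ?E a w) \<in> ?K" if "a \<in> ?A" for a
      using that quantum_proj_kernel_complement_proj[OF assms(1)]
      by (simp add: kernel_eq N.diff_mem Em quantum_proj_diff)
    then show "continuous_map ?T (prod_topology (subtopology ?T ?K) (subtopology ?T M))
        (\<lambda>a. (\<lambda>w. a w - ?E a w, ?E a))"
      by (intro continuous_map_pairedI continuous_map_into_subtopology
          continuous_map_kernel_proj[OF assms] continuous_map_kernel_complement_proj[OF assms])
         (auto simp: T M_def Em EE)
  next
    fix x assume "x \<in> topspace (prod_topology (subtopology ?T ?K) (subtopology ?T M))"
    then obtain a b where [simp]: "x = (a, b)" and a: "a \<in> ?K" and b: "?E b = b"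
      by (auto simp: M_def)
    have "?E (\<lambda>w. a w + b w) = b" by (simp add: E_add EK[OF a] b)
    then show "(case case x of (a, b) \<Rightarrow> a \<oplus>\<^bsub>free_ball n r\<^esub> b of a \<Rightarrow> (\<lambda>w. a w - ?E a w, ?E a)) = x"
      by (simp add: free_ball_simps)
  qed (simp add: free_ball_simps)
  ultimately show ?thesis
    unfolding complemented_subspace_def homeomorphic_map_maps
    using closedin_kernel[OF assms] by blast
qed

text \<open>The infimum is a minimum, attained at \<open>quantum_lift q n f\<close>, which also
  shows that the set is nonempty; the lower bound is \<open>quantum_proj_norm\<close>.\<close>

lemma quantum_norm_eq_quotient_norm:
  assumes "q \<noteq> 0" "\<rho> \<in> radii r" "f \<in> quantum_ball_carrier q n r"
  shows "quantum_norm q n \<rho> f =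
    Inf {free_norm_circ n \<rho> a | a. a \<in> free_ball_carrier n r \<and> quantum_proj q n a = f}"
proof (rule cInf_eq_minimum[symmetric])
  have "quantum_proj q n (quantum_lift q n f) = f"
    using assms(3) by (intro quantum_proj_lift[OF assms(1)]) (auto simp: quantum_ball_carrier_def)
  then show "quantum_norm q n \<rho> f \<in> {free_norm_circ n \<rho> a | a. a \<in> free_ball_carrier n r \<and> quantum_proj q n a = f}"
    using quantum_lift_circ[OF assms(1), of n \<rho> f] quantum_lift_mem[OF assms(1,3)] by force
qed (use quantum_proj_norm(2)[OF assms(1) _ assms(2)] in auto)

theorem theorem4p10:
  fixes q :: complex and n :: nat and r :: ereal
  assumes "q \<noteq> 0" and "1 \<le> n" and "0 < r"
  shows "\<exists>\<pi>.
    \<pi> \<in> alg_hom (free_ball n r) (quantum_ball q n r) \<and>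
    continuous_map (free_ball_topology n r) (quantum_ball_topology q n r) \<pi> \<and>
    \<pi> ` carrier (free_ball n r) = carrier (quantum_ball q n r) \<and>
    (\<forall>i \<in> {1..n}. \<pi> (free_gen i) = quantum_gen i) \<and>
    a_kernel (free_ball n r) (quantum_ball q n r) \<pi> =
      closed_ideal_generated (free_ball n r) (free_ball_topology n r) (q_commutators q n r) \<and>
    complemented_subspace (free_ball n r) (free_ball_topology n r)
      (a_kernel (free_ball n r) (quantum_ball q n r) \<pi>) \<and>
    (\<forall>\<rho> \<in> radii r. \<forall>f \<in> carrier (quantum_ball q n r).
      quantum_norm q n \<rho> f =
        Inf {free_norm_circ n \<rho> a | a. a \<in> carrier (free_ball n r) \<and> \<pi> a = f})"
proof (intro exI[of _ "quantum_proj q n"] conjI)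
  show "quantum_proj q n ` carrier (free_ball n r) = carrier (quantum_ball q n r)"
  proof
    show "carrier (quantum_ball q n r) \<subseteq> quantum_proj q n ` carrier (free_ball n r)"
    proof
      fix f assume f: "f \<in> carrier (quantum_ball q n r)"
      then have "quantum_proj q n (quantum_lift q n f) = f"
        by (intro quantum_proj_lift[OF assms(1)]) (auto simp: quantum_ball_simps quantum_ball_carrier_def)
      then show "f \<in> quantum_proj q n ` carrier (free_ball n r)"
        using quantum_lift_mem[OF assms(1)] f by (force simp: free_ball_simps quantum_ball_simps)
    qed
  qed (auto simp: free_ball_simps quantum_ball_simps quantum_proj_mem[OF assms(1)])
  show "\<forall>\<rho> \<in> radii r. \<forall>f \<in> carrier (quantum_ball q n r). quantum_norm q n \<rho> f =
      Inf {free_norm_circ n \<rho> a | a. a \<in> carrier (free_ball n r) \<and> quantum_proj q n a = f}"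
    using quantum_norm_eq_quotient_norm[OF assms(1)] by (simp add: free_ball_simps quantum_ball_simps)
qed (use assms in \<open>auto simp: quantum_proj_hom continuous_map_quantum_proj quantum_proj_gen
    kernel_eq_closed_ideal_generated[symmetric] complemented_kernel\<close>)

end
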